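(* Up to isomorphism, properly feudal fusion rules are in one-to-one correspondence with group homomorphisms $u\colon S\to G$ such that $|\mathrm{coker}\,u|=2$ (i.e. $\mathrm{im}\,u$ has index $2$ in $G$) and $\ker u$ is nontrivial and finite. Here homomorphisms $u\colon S\to G$ and $\tilde u\colon\tilde S\to\tilde G$ are isomorphic if there are group isomorphisms $h_0\colon S\to\tilde S$ and $h_1\colon G\to\tilde G$ with $h_1u=\tilde uh_0$.
   Context: A multiset over a set $L$ is a function $X\in\mathbb{N}^L$ ($0\in\mathbb N$), with value $\langle X,x\rangle$ at $x$; it is finite if it has finite support. A multimagma is a set $L$ with an operation $L\times L\to\mathbb{N}^L$, $(x,y)\mapsto xy$; it is locally finite if every $xy$ is finite. For finite $X,Y\in\mathbb{N}^L$ put $\langle XY,z\rangle=\sum_{x,y\in L}\langle X,x\rangle\langle Y,y\rangle\langle xy,z\rangle$. Subsets of a set are identified with their indicator functions, and an element $x$ with the singleton $\{x\}$. A fusion rule is a locally finite multimagma $L$ such that $(xy)z=x(yz)$ for all $x,y,z$; there is $1\in L$ with $1x=x1=x$ for all $x$; and for every $x$ there is $\bar x\in L$ with $\langle xy,1\rangle=\langle yx,1\rangle=\delta_{y,\bar x}$ for all $y\in L$. An isomorphism of fusion rules is a bijection preserving the operation. For a multiset $X$ let $\lfloor X\rfloor=\{x:\langle X,x\rangle>0\}$. A subset $T\ni1$ of a fusion rule $L$ is a subrule if $z\in T$ whenever $\bar z\in T$ or $z\in\lfloor xy\rfloor$ for some $x,y\in T$. The index of a subset $T\subseteq L$ is the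 cardinality of the set of left cosets $\{\lfloor xT\rfloor: x\in L\}$. The adjoint subrule $L_{\mathrm{ad}}$ is the smallest subrule containing $\lfloor x\bar x\rfloor$ for all $x\in L$. With $L^{(0)}=L$ and $L^{(n+1)}=(L^{(n)})_{\mathrm{ad}}$, $L$ is nilpotent if $L^{(n)}=\{1\}$ for some $n\in\mathbb{N}$. An element $a\in L$ is a simple current if $a\bar a=1$. The simple current index of $L$ is the index of its set of simple currents. A fusion rule is properly feudal if it is nilpotent with simple current index $2$. *)

theory Defs
  imports "HOL-Algebra.Coset" "HOL-Library.Indicator_Function"
begin

section \<open>Multisets and multimagmas\<close>

text \<open>
  A multiset over the set \<open>carrier L\<close> is represented by a function into \<^typ>\<open>nat\<close> of which only the
  values on \<open>carrier L\<close> count; \<open>fusion L x y z\<close> is the multiplicity of \<open>z\<close> in \<open>xy\<close>.  Subsets are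
  turned into multisets by \<^const>\<open>indicator\<close>.
\<close>

record 'a multimagma = "'a partial_object" +
  fusion :: "'a \<Rightarrow> 'a \<Rightarrow> 'a \<Rightarrow> nat"

definition ms_eq :: "('a, 'm) multimagma_scheme \<Rightarrow> ('a \<Rightarrow> nat) \<Rightarrow> ('a \<Rightarrow> nat) \<Rightarrow> bool"
  where "ms_eq L X Y \<longleftrightarrow> (\<forall>z\<in>carrier L. X z = Y z)"

definition ms_supp :: "('a, 'm) multimagma_scheme \<Rightarrow> ('a \<Rightarrow> nat) \<Rightarrow> 'a set"
  where "ms_supp L X = {z \<in> carrier L. X z > 0}"

text \<open>
  The sum over all pairs of elements of \<open>L\<close> is restricted to the supports, since \<^const>\<open>sum\<close>
  vanishes on infinite index sets.  Only used for multisets of finite support.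
\<close>

definition ms_prod ::
    "('a, 'm) multimagma_scheme \<Rightarrow> ('a \<Rightarrow> nat) \<Rightarrow> ('a \<Rightarrow> nat) \<Rightarrow> 'a \<Rightarrow> nat"
  where "ms_prod L X Y z = (\<Sum>x\<in>ms_supp L X. \<Sum>y\<in>ms_supp L Y. X x * Y y * fusion L x y z)"

definition locally_finite :: "('a, 'm) multimagma_scheme \<Rightarrow> bool"
  where "locally_finite L \<longleftrightarrow> (\<forall>x\<in>carrier L. \<forall>y\<in>carrier L. finite (ms_supp L (fusion L x y)))"

definition mm_iso :: "'a multimagma \<Rightarrow> 'b multimagma \<Rightarrow> bool"
  where "mm_iso L M \<longleftrightarrow> (\<exists>f. bij_betw f (carrier L) (carrier M) \<and>
    (\<forall>x\<in>carrier L. \<forall>y\<in>carrier L. \<forall>z\<in>carrier L. fusion M (f x) (f y) (f z) = fusion L x y z))"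


section \<open>Fusion rules\<close>

definition is_unit_elt :: "('a, 'm) multimagma_scheme \<Rightarrow> 'a \<Rightarrow> bool"
  where "is_unit_elt L e \<longleftrightarrow> e \<in> carrier L \<and>
    (\<forall>x\<in>carrier L. ms_eq L (fusion L e x) (indicator {x}) \<and> ms_eq L (fusion L x e) (indicator {x}))"

definition is_dual_elt :: "('a, 'm) multimagma_scheme \<Rightarrow> 'a \<Rightarrow> 'a \<Rightarrow> 'a \<Rightarrow> bool"
  where "is_dual_elt L e x b \<longleftrightarrow> b \<in> carrier L \<and>
    (\<forall>y\<in>carrier L. fusion L x y e = (if y = b then 1 else 0) \<and>
                    fusion L y x e = (if y = b then 1 else 0))"

definition fusion_rule :: "('a, 'm) multimagma_scheme \<Rightarrow> bool"
  where "fusion_rule L \<longleftrightarrow> locally_finite L \<and>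
    (\<forall>x\<in>carrier L. \<forall>y\<in>carrier L. \<forall>z\<in>carrier L.
       ms_eq L (ms_prod L (fusion L x y) (indicator {z})) (ms_prod L (indicator {x}) (fusion L y z))) \<and>
    (\<exists>e. is_unit_elt L e \<and> (\<forall>x\<in>carrier L. \<exists>b. is_dual_elt L e x b))"

text \<open>In a fusion rule the unit and the dual of each element are unique.\<close>

definition fr_one :: "('a, 'm) multimagma_scheme \<Rightarrow> 'a"
  where "fr_one L = (THE e. is_unit_elt L e)"

definition fr_bar :: "('a, 'm) multimagma_scheme \<Rightarrow> 'a \<Rightarrow> 'a"
  where "fr_bar L x = (THE b. is_dual_elt L (fr_one L) x b)"


section \<open>Subrules, index and nilpotency\<close>

definition subrule :: "('a, 'm) multimagma_scheme \<Rightarrow> 'a set \<Rightarrow> bool"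
  where "subrule L T \<longleftrightarrow> T \<subseteq> carrier L \<and> fr_one L \<in> T \<and>
    (\<forall>z\<in>carrier L. fr_bar L z \<in> T \<or> (\<exists>x\<in>T. \<exists>y\<in>T. z \<in> ms_supp L (fusion L x y)) \<longrightarrow> z \<in> T)"

text \<open>
  The support of the product of \<open>x\<close> with the (possibly infinite) subset \<open>T\<close>: the multiplicity of \<open>z\<close>
  in \<open>xT\<close> is the sum of its multiplicities in \<open>xt\<close> for \<open>t \<in> T\<close>.
\<close>

definition left_coset :: "('a, 'm) multimagma_scheme \<Rightarrow> 'a \<Rightarrow> 'a set \<Rightarrow> 'a set"
  where "left_coset L x T = (\<Union>t\<in>T. ms_supp L (fusion L x t))"

text \<open>As usual for \<^const>\<open>card\<close>, an infinite index is rendered as \<open>0\<close>.\<close>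

definition fr_index :: "('a, 'm) multimagma_scheme \<Rightarrow> 'a set \<Rightarrow> nat"
  where "fr_index L T = card ((\<lambda>x. left_coset L x T) ` carrier L)"

definition adjoint_subrule :: "('a, 'm) multimagma_scheme \<Rightarrow> 'a set"
  where "adjoint_subrule L =
    \<Inter>{T. subrule L T \<and> (\<forall>x\<in>carrier L. ms_supp L (fusion L x (fr_bar L x)) \<subseteq> T)}"

text \<open>Each term of the series is a fusion rule in its own right, with the restricted operation.\<close>

primrec adjoint_series :: "'a multimagma \<Rightarrow> nat \<Rightarrow> 'a multimagma"
  where
    "adjoint_series L 0 = L"
  | "adjoint_series L (Suc n) =
       (adjoint_series L n)\<lparr>carrier := adjoint_subrule (adjoint_series L n)\<rparr>"

definition nilpotent :: "'a multimagma \<Rightarrow> bool"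
  where "nilpotent L \<longleftrightarrow> (\<exists>n. carrier (adjoint_series L n) = {fr_one L})"

definition simple_currents :: "('a, 'm) multimagma_scheme \<Rightarrow> 'a set"
  where "simple_currents L =
    {a \<in> carrier L. ms_eq L (fusion L a (fr_bar L a)) (indicator {fr_one L})}"

definition properly_feudal :: "'a multimagma \<Rightarrow> bool"
  where "properly_feudal L \<longleftrightarrow>
    fusion_rule L \<and> nilpotent L \<and> fr_index L (simple_currents L) = 2"


section \<open>Group homomorphisms\<close>

type_synonym ('s, 'g) hom_data = "'s monoid \<times> 'g monoid \<times> ('s \<Rightarrow> 'g)"

definition feudal_hom :: "('s, 'g) hom_data \<Rightarrow> bool"
  where "feudal_hom = (\<lambda>(S, G, u). group S \<and> group G \<and> u \<in> hom S G \<and>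
    card (rcosets\<^bsub>G\<^esub> (u ` carrier S)) = 2 \<and>
    kernel S G u \<noteq> {\<one>\<^bsub>S\<^esub>} \<and> finite (kernel S G u))"

definition hom_iso :: "('s, 'g) hom_data \<Rightarrow> ('t, 'h) hom_data \<Rightarrow> bool"
  where "hom_iso = (\<lambda>(S, G, u) (S', G', u').
    \<exists>h0 \<in> iso S S'. \<exists>h1 \<in> iso G G'. \<forall>s\<in>carrier S. h1 (u s) = u' (h0 s))"


section \<open>The correspondence\<close>

text \<open>
  The fusion rule attached to \<open>u: S \<rightarrow> G\<close> lives on the disjoint union of \<open>S\<close> and \<open>G - im u\<close>.  The group
  \<open>S\<close> acts on \<open>G - im u\<close> from both sides through \<open>u\<close>, and the product of two elements \<open>g, h\<close> of
  \<open>G - im u\<close> is the fibre of \<open>u\<close> over \<open>gh\<close>, which lies in \<open>im u\<close> when \<open>im u\<close> has index 2.  For a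
  finite abelian group \<open>S\<close> and the trivial homomorphism to a group of order 2 this is the
  Tambara-Yamagami fusion rule of \<open>S\<close>.
\<close>

fun feudal_fusion :: "('s, 'g) hom_data \<Rightarrow> 's + 'g \<Rightarrow> 's + 'g \<Rightarrow> 's + 'g \<Rightarrow> nat"
  where
    "feudal_fusion (S, G, u) (Inl s) (Inl t) = indicator {Inl (s \<otimes>\<^bsub>S\<^esub> t)}"
  | "feudal_fusion (S, G, u) (Inl s) (Inr g) = indicator {Inr (u s \<otimes>\<^bsub>G\<^esub> g)}"
  | "feudal_fusion (S, G, u) (Inr g) (Inl s) = indicator {Inr (g \<otimes>\<^bsub>G\<^esub> u s)}"
  | "feudal_fusion (S, G, u) (Inr g) (Inr h) =
       indicator (Inl ` {s \<in> carrier S. u s = g \<otimes>\<^bsub>G\<^esub> h})"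

definition feudal_of_hom :: "('s, 'g) hom_data \<Rightarrow> ('s + 'g) multimagma"
  where "feudal_of_hom = (\<lambda>(S, G, u).
    \<lparr>carrier = Inl ` carrier S \<union> Inr ` (carrier G - u ` carrier S),
     fusion = feudal_fusion (S, G, u)\<rparr>)"

text \<open>
  Isomorphism classes are formed among structures whose underlying sets are subsets of one type \<open>'a\<close>;
  structures differing only off their carriers are isomorphic.
\<close>

definition feudal_hom_iso :: "(('a, 'a) hom_data \<times> ('a, 'a) hom_data) set"
  where "feudal_hom_iso = {(u, v). feudal_hom u \<and> feudal_hom v \<and> hom_iso u v}"

definition feudal_hom_classes :: "('a, 'a) hom_data set set"
  where "feudal_hom_classes = {u. feudal_hom u} // feudal_hom_iso"

definition properly_feudal_iso :: "('a multimagma \<times> 'a multimagma) set"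
  where "properly_feudal_iso = {(L, M). properly_feudal L \<and> properly_feudal M \<and> mm_iso L M}"

definition properly_feudal_classes :: "'a multimagma set set"
  where "properly_feudal_classes = {L. properly_feudal L} // properly_feudal_iso"

text \<open>
  Since \<^const>\<open>feudal_of_hom\<close> changes the type, a class of homomorphisms is sent to all copies in \<open>'a\<close>
  of the attached fusion rules.
\<close>

definition feudal_class_of :: "('a, 'a) hom_data set \<Rightarrow> 'a multimagma set"
  where "feudal_class_of C = {L. \<exists>u\<in>C. mm_iso L (feudal_of_hom u)}"

end

theory Submission imports Defs
begin

text \<open>
  The fusion rule of \<open>u: S \<rightarrow> G\<close> has underlying set \<open>S \<squnion> R\<close>, where \<open>R = G - im u\<close>.  Its adjoint subrule
  is the kernel of \<open>u\<close>, because \<open>s s\<inverse> = 1\<close> for \<open>s \<in> S\<close> and \<open>g g\<inverse> = ker u\<close> for \<open>g \<in> R\<close>; the kernel consists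
  of simple currents, so the next step of the adjoint series is trivial.  As the kernel is nontrivial,
  no element of \<open>R\<close> is a simple current, and the cosets of \<open>S\<close> are \<open>S\<close> and \<open>R\<close> themselves
  (\<open>properly_feudal_M\<close>).

  Conversely, let \<open>L\<close> be properly feudal, \<open>S\<close> its group of simple currents and \<open>R\<close> the complement.
  Multiplication by a simple current permutes \<open>L\<close>, and as \<open>S\<close> has only two cosets, it acts transitively
  on \<open>R\<close>, from both sides.  The product \<open>x (bar x)\<close> does not change when \<open>x\<close> is replaced by \<open>x a\<close> with \<open>a\<close> a simple
  current, hence it is the same multiset \<open>N\<close> for all \<open>x \<in> R\<close>.  If \<open>N\<close> met \<open>R\<close>, then the adjoint subrule,
  which is generated by \<open>N\<close>, would be its own adjoint subrule, against nilpotency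
  (\<open>square_subset_currents\<close>).  So \<open>N \<subseteq> S\<close>, and the cyclic symmetry of the multiplicities shows that \<open>N\<close> is
  the common stabiliser of the elements of \<open>R\<close> (\<open>square_eq_kern\<close>).  It is a finite nontrivial normal
  subgroup of \<open>S\<close>, the subsets \<open>N x\<close> of \<open>L\<close> form a group \<open>G\<close> under multiplication of supports, and \<open>s \<mapsto> N s\<close>
  is the homomorphism that gives back \<open>L\<close> (\<open>mm_iso_feudal_of_hom\<close>).

  An isomorphism of two such fusion rules preserves simple currents, hence consists of an isomorphism
  \<open>S \<rightarrow> S'\<close> and a bijection \<open>R \<rightarrow> R'\<close>; together they determine the isomorphism \<open>G \<rightarrow> G'\<close>
  (\<open>mm_iso_imp_hom_iso\<close>).  Infinity of the type gives every fusion rule on a subset of the disjoint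
  sum a copy in the type itself, so that the class attached to a homomorphism is never empty.
\<close>


section \<open>Fusion rules\<close>

lemma fr_one_eq:
  assumes "is_unit_elt L e"
  shows "fr_one L = e"
  unfolding fr_one_def
proof (rule the_equality)
  fix e' assume "is_unit_elt L e'"
  with assms have "indicator {e} e = (indicator {e'} e :: nat)"
    unfolding is_unit_elt_def ms_eq_def by metis
  then show "e' = e" by (simp add: indicator_def of_bool_def split: if_splits)
qed (fact assms)

lemma fr_bar_eq:
  assumes "is_unit_elt L e" and "is_dual_elt L e x b"
  shows "fr_bar L x = b"
  unfolding fr_bar_def fr_one_eq[OF assms(1)]
proof (rule the_equality)
  fix b' assume "is_dual_elt L e x b'"
  with assms(2) show "b' = b"
    unfolding is_dual_elt_def by (metis zero_neq_one)
qed (fact assms(2))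

lemma ms_supp_singleton [simp]: "x \<in> carrier L \<Longrightarrow> ms_supp L (indicator {x}) = {x}"
  by (auto simp: ms_supp_def indicator_def split: if_splits)

lemma ms_supp_subset: "ms_supp L X \<subseteq> carrier L"
  by (auto simp: ms_supp_def)

lemma ms_supp_cong: "ms_eq L X Y \<Longrightarrow> ms_supp L X = ms_supp L Y"
  by (auto simp: ms_supp_def ms_eq_def)

definition fusion_assoc :: "('a, 'm) multimagma_scheme \<Rightarrow> bool"
  where "fusion_assoc L \<longleftrightarrow> (\<forall>x\<in>carrier L. \<forall>y\<in>carrier L. \<forall>z\<in>carrier L. \<forall>v\<in>carrier L.
    (\<Sum>w\<in>ms_supp L (fusion L x y). fusion L x y w * fusion L w z v) =
    (\<Sum>w\<in>ms_supp L (fusion L y z). fusion L y z w * fusion L x w v))"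

lemma fusion_rule_iff:
  "fusion_rule L \<longleftrightarrow> locally_finite L \<and> fusion_assoc L \<and>
    (\<exists>e. is_unit_elt L e \<and> (\<forall>x\<in>carrier L. \<exists>b. is_dual_elt L e x b))"
proof -
  have "ms_prod L X (indicator {z}) v = (\<Sum>w\<in>ms_supp L X. X w * fusion L w z v)"
    and "ms_prod L (indicator {z}) X v = (\<Sum>w\<in>ms_supp L X. X w * fusion L z w v)"
    if "z \<in> carrier L" for X z v
    using that by (simp_all add: ms_prod_def)
  then have "(\<forall>x\<in>carrier L. \<forall>y\<in>carrier L. \<forall>z\<in>carrier L.
      ms_eq L (ms_prod L (fusion L x y) (indicator {z})) (ms_prod L (indicator {x}) (fusion L y z)))
      \<longleftrightarrow> fusion_assoc L"
    by (simp add: ms_eq_def fusion_assoc_def)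
  then show ?thesis
    unfolding fusion_rule_def by blast
qed

text \<open>
  Most of the argument is about supports only, where products of arbitrary, also infinite, subsets make sense.
\<close>

definition set_prod :: "('a, 'm) multimagma_scheme \<Rightarrow> 'a set \<Rightarrow> 'a set \<Rightarrow> 'a set"
  where "set_prod L A B = (\<Union>x\<in>A. \<Union>y\<in>B. ms_supp L (fusion L x y))"

lemma left_coset_eq: "left_coset L x T = set_prod L {x} T"
  by (simp add: left_coset_def set_prod_def)

locale fusion_struct =
  fixes L :: "('a, 'm) multimagma_scheme"
  assumes is_fusion_rule: "fusion_rule L"
begin

abbreviation one ("\<epsilon>") where "\<epsilon> \<equiv> fr_one L"
abbreviation bar where "bar \<equiv> fr_bar L"
abbreviation sprod (infixl "\<star>" 70) where "A \<star> B \<equiv> set_prod L A B"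

lemma unit: "is_unit_elt L \<epsilon>"
proof -
  obtain e where "is_unit_elt L e"
    using is_fusion_rule unfolding fusion_rule_iff by auto
  with fr_one_eq[OF this] show ?thesis by simp
qed

lemma dual: "x \<in> carrier L \<Longrightarrow> is_dual_elt L \<epsilon> x (bar x)"
proof -
  assume "x \<in> carrier L"
  with is_fusion_rule obtain e b where e: "is_unit_elt L e" and b: "is_dual_elt L e x b"
    unfolding fusion_rule_iff by blast
  with fr_one_eq[OF e] fr_bar_eq[OF e b] show ?thesis by simp
qed

lemma one_closed [simp]: "\<epsilon> \<in> carrier L"
  using unit by (simp add: is_unit_elt_def)

lemma bar_closed [simp]: "x \<in> carrier L \<Longrightarrow> bar x \<in> carrier L"
  using dual by (simp add: is_dual_elt_def)

lemma fusion_one: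
  assumes "x \<in> carrier L" "z \<in> carrier L"
  shows "fusion L \<epsilon> x z = (if z = x then 1 else 0)" "fusion L x \<epsilon> z = (if z = x then 1 else 0)"
  using unit assms by (auto simp: is_unit_elt_def ms_eq_def indicator_def)

lemma fusion_to_one:
  assumes "x \<in> carrier L" "y \<in> carrier L"
  shows "fusion L x y \<epsilon> = (if y = bar x then 1 else 0)" "fusion L y x \<epsilon> = (if y = bar x then 1 else 0)"
  using dual[OF assms(1)] assms by (auto simp: is_dual_elt_def)

lemma bar_unique: "x \<in> carrier L \<Longrightarrow> y \<in> carrier L \<Longrightarrow> fusion L x y \<epsilon> > 0 \<Longrightarrow> y = bar x"
  using fusion_to_one(1)[of x y] by (auto split: if_splits)

lemma bar_bar [simp]: "x \<in> carrier L \<Longrightarrow> bar (bar x) = x"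
  using bar_unique[of "bar x" x] fusion_to_one(2)[of x "bar x"] by simp

lemma bar_one [simp]: "bar \<epsilon> = \<epsilon>"
  using bar_unique[of \<epsilon> \<epsilon>] fusion_one(1)[of \<epsilon> \<epsilon>] by simp

lemma finite_supp: "x \<in> carrier L \<Longrightarrow> y \<in> carrier L \<Longrightarrow> finite (ms_supp L (fusion L x y))"
  using is_fusion_rule by (auto simp: fusion_rule_iff locally_finite_def)

lemma assoc:
  assumes "x \<in> carrier L" "y \<in> carrier L" "z \<in> carrier L" "v \<in> carrier L"
  shows "(\<Sum>w\<in>ms_supp L (fusion L x y). fusion L x y w * fusion L w z v) =
    (\<Sum>w\<in>ms_supp L (fusion L y z). fusion L y z w * fusion L x w v)"
  using is_fusion_rule assms by (auto simp: fusion_rule_iff fusion_assoc_def)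

text \<open>
  Both sides are the multiplicity of the unit in \<open>xyz\<close>: associativity turns this number into a
  cyclically symmetric function of the three factors.
\<close>

lemma fusion_rotate:
  assumes "x \<in> carrier L" "y \<in> carrier L" "z \<in> carrier L"
  shows "fusion L x y (bar z) = fusion L y z (bar x)"
proof -
  have "(\<Sum>w\<in>ms_supp L (fusion L x y). fusion L x y w * fusion L w z \<epsilon>) =
      (\<Sum>w\<in>ms_supp L (fusion L x y). if w = bar z then fusion L x y w else 0)"
    using assms by (intro sum.cong) (auto simp: fusion_to_one ms_supp_def)
  also have "\<dots> = fusion L x y (bar z)"
    using assms finite_supp[of x y] by (simp add: ms_supp_def)
  finally have l: "(\<Sum>w\<in>ms_supp L (fusion L x y). fusion L x y w * fusion L w z \<epsilon>) = fusion L x y (bar z)" .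
  have "(\<Sum>w\<in>ms_supp L (fusion L y z). fusion L y z w * fusion L x w \<epsilon>) =
      (\<Sum>w\<in>ms_supp L (fusion L y z). if w = bar x then fusion L y z w else 0)"
    using assms by (intro sum.cong) (auto simp: fusion_to_one ms_supp_def)
  also have "\<dots> = fusion L y z (bar x)"
    using assms finite_supp[of y z] by (simp add: ms_supp_def)
  finally show ?thesis
    using assoc[of x y z \<epsilon>] assms l by simp
qed

lemma fusion_rotate':
  assumes "x \<in> carrier L" "y \<in> carrier L" "z \<in> carrier L"
  shows "fusion L x y z = fusion L y (bar z) (bar x)" "fusion L x y z = fusion L (bar z) x (bar y)"
  using fusion_rotate[of x y "bar z"] fusion_rotate[of "bar z" x y] assms by simp_all

lemma in_sprod: "z \<in> A \<star> B \<longleftrightarrow> z \<in> carrier L \<and> (\<exists>x\<in>A. \<exists>y\<in>B. fusion L x y z > 0)"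
  by (auto simp: set_prod_def ms_supp_def)

lemma sprod_closed: "A \<star> B \<subseteq> carrier L"
  by (auto simp: in_sprod)

lemma sprodE:
  assumes "z \<in> A \<star> B"
  obtains x y where "x \<in> A" "y \<in> B" "z \<in> {x} \<star> {y}"
  using assms by (auto simp: set_prod_def)

lemma sprod_mono: "A \<subseteq> A' \<Longrightarrow> B \<subseteq> B' \<Longrightarrow> A \<star> B \<subseteq> A' \<star> B'"
  by (auto simp: set_prod_def)

lemma sprod_one [simp]: "A \<subseteq> carrier L \<Longrightarrow> {\<epsilon>} \<star> A = A" "A \<subseteq> carrier L \<Longrightarrow> A \<star> {\<epsilon>} = A"
  by (auto simp: in_sprod fusion_one subset_iff split: if_splits)


text \<open>
  Multiplicities are nonnegative, so no cancellation can occur in the two sums of the associativity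
  law, and the law passes to supports.
\<close>

lemma sprod_assoc:
  assumes "A \<subseteq> carrier L" "B \<subseteq> carrier L" "C \<subseteq> carrier L"
  shows "(A \<star> B) \<star> C = A \<star> (B \<star> C)"
proof -
  have key: "(\<exists>w\<in>carrier L. fusion L x y w > 0 \<and> fusion L w z v > 0) \<longleftrightarrow>
      (\<exists>w\<in>carrier L. fusion L y z w > 0 \<and> fusion L x w v > 0)"
    if "x \<in> carrier L" "y \<in> carrier L" "z \<in> carrier L" "v \<in> carrier L" for x y z v
  proof -
    have "(\<exists>w\<in>carrier L. fusion L x y w > 0 \<and> fusion L w z v > 0) \<longleftrightarrow>
        (\<Sum>w\<in>ms_supp L (fusion L x y). fusion L x y w * fusion L w z v) \<noteq> 0"
      using finite_supp[of x y] that by (auto simp: ms_supp_def)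
    also have "\<dots> \<longleftrightarrow> (\<Sum>w\<in>ms_supp L (fusion L y z). fusion L y z w * fusion L x w v) \<noteq> 0"
      using assoc that by simp
    also have "\<dots> \<longleftrightarrow> (\<exists>w\<in>carrier L. fusion L y z w > 0 \<and> fusion L x w v > 0)"
      using finite_supp[of y z] that by (auto simp: ms_supp_def)
    finally show ?thesis .
  qed
  show ?thesis
  proof (rule Set.set_eqI)
    fix v
    have "v \<in> (A \<star> B) \<star> C \<longleftrightarrow> v \<in> carrier L \<and> (\<exists>x\<in>A. \<exists>y\<in>B. \<exists>z\<in>C.
        \<exists>w\<in>carrier L. fusion L x y w > 0 \<and> fusion L w z v > 0)"
      unfolding in_sprod Bex_def by blast
    also have "\<dots> \<longleftrightarrow> v \<in> carrier L \<and> (\<exists>x\<in>A. \<exists>y\<in>B. \<exists>z\<in>C.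
        \<exists>w\<in>carrier L. fusion L y z w > 0 \<and> fusion L x w v > 0)"
      by (rule conj_cong[OF refl], (rule bex_cong[OF refl])?, (rule bex_cong[OF refl])?,
          (rule bex_cong[OF refl])?, rule key) (use assms in auto)
    also have "\<dots> \<longleftrightarrow> v \<in> A \<star> (B \<star> C)"
      unfolding in_sprod Bex_def by blast
    finally show "v \<in> (A \<star> B) \<star> C \<longleftrightarrow> v \<in> A \<star> (B \<star> C)" .
  qed
qed

lemma one_in_sprod_bar:
  assumes "x \<in> carrier L"
  shows "\<epsilon> \<in> {x} \<star> {bar x}" "\<epsilon> \<in> {bar x} \<star> {x}"
  using assms by (simp_all add: in_sprod fusion_to_one)

text \<open>If \<open>xy\<close> were empty, so would be \<open>(xy)(bar y) = x(y (bar y))\<close>, which contains \<open>x\<close>.\<close>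

lemma sprod_nonempty:
  assumes "x \<in> carrier L" "y \<in> carrier L"
  shows "{x} \<star> {y} \<noteq> {}"
proof
  assume "{x} \<star> {y} = {}"
  then have "{x} \<star> ({y} \<star> {bar y}) = {}"
    using sprod_assoc[of "{x}" "{y}" "{bar y}"] assms by (simp add: set_prod_def)
  moreover have "x \<in> {x} \<star> ({y} \<star> {bar y})"
    using sprod_mono[of "{x}" "{x}" "{\<epsilon>}" "{y} \<star> {bar y}"] one_in_sprod_bar[of y] assms by auto
  ultimately show False by simp
qed

lemma bar_eq_sprod:
  assumes "x \<in> carrier L" "y \<in> carrier L" "\<epsilon> \<in> {x} \<star> {y}"
  shows "y = bar x"
  using assms by (auto simp: in_sprod intro: bar_unique)


subsection \<open>Subrules\<close>

abbreviation restr where "restr T \<equiv> L\<lparr>carrier := T\<rparr>"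

lemma subrule_subset: "subrule L T \<Longrightarrow> T \<subseteq> carrier L"
  by (simp add: subrule_def)

lemma subrule_one_mem: "subrule L T \<Longrightarrow> \<epsilon> \<in> T"
  unfolding subrule_def by (elim conjE)

lemma subrule_mem:
  assumes "subrule L T" "z \<in> carrier L" "bar z \<in> T \<or> (\<exists>x\<in>T. \<exists>y\<in>T. z \<in> ms_supp L (fusion L x y))"
  shows "z \<in> T"
  using assms unfolding subrule_def by (elim conjE) (drule (1) bspec, erule (1) mp)

lemma subrule_bar: "subrule L T \<Longrightarrow> x \<in> T \<Longrightarrow> bar x \<in> T"
  using subrule_mem[of T "bar x"] subrule_subset[of T] by auto

lemma subrule_supp:
  assumes "subrule L T" "x \<in> T" "y \<in> T"
  shows "ms_supp (restr T) (fusion L x y) = ms_supp L (fusion L x y)"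
proof -
  have "ms_supp L (fusion L x y) \<subseteq> T"
  proof
    fix z assume z: "z \<in> ms_supp L (fusion L x y)"
    then have "\<exists>x\<in>T. \<exists>y\<in>T. z \<in> ms_supp L (fusion L x y)"
      using assms(2,3) by blast
    with subrule_mem[OF assms(1), of z] z show "z \<in> T"
      by (simp add: ms_supp_def)
  qed
  then show ?thesis
    using assms(1) by (auto simp: ms_supp_def subrule_def)
qed

lemma subrule_unit: "subrule L T \<Longrightarrow> is_unit_elt (restr T) \<epsilon>"
  using unit by (auto simp: is_unit_elt_def subrule_def ms_eq_def)

lemma subrule_dual: "subrule L T \<Longrightarrow> x \<in> T \<Longrightarrow> is_dual_elt (restr T) \<epsilon> x (bar x)"
  using dual[of x] subrule_bar[of T x] subrule_subset[of T]
  by (simp add: is_dual_elt_def subset_iff)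

lemma subrule_one: "subrule L T \<Longrightarrow> fr_one (restr T) = \<epsilon>"
  by (rule fr_one_eq[OF subrule_unit])

lemma subrule_bar_eq: "subrule L T \<Longrightarrow> x \<in> T \<Longrightarrow> fr_bar (restr T) x = bar x"
  by (rule fr_bar_eq[OF subrule_unit subrule_dual])

lemma subrule_fusion_rule:
  assumes "subrule L T"
  shows "fusion_rule (restr T)"
proof -
  note T = subrule_subset[OF assms]
  have "locally_finite (restr T)"
    using T finite_supp by (auto simp: locally_finite_def subrule_supp[OF assms])
  moreover have "fusion_assoc (restr T)"
    using T assoc by (auto simp: fusion_assoc_def subrule_supp[OF assms] subset_iff)
  ultimately show ?thesis
    unfolding fusion_rule_iff using subrule_unit[OF assms] subrule_dual[OF assms] by auto
qed

lemma subrule_carrier: "subrule L (carrier L)"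
  by (auto simp: subrule_def)

lemma subrule_adjoint: "subrule L (adjoint_subrule L)"
proof -
  have "adjoint_subrule L \<subseteq> carrier L"
    unfolding adjoint_subrule_def using subrule_carrier by (auto simp: ms_supp_def)
  moreover have "subrule L (\<Inter>\<T>)" if "\<Inter>\<T> \<subseteq> carrier L" "\<forall>T\<in>\<T>. subrule L T" for \<T>
  proof -
    have mem: "z \<in> T"
      if "z \<in> carrier L" "T \<in> \<T>"
        and z: "bar z \<in> \<Inter>\<T> \<or> (\<exists>x\<in>\<Inter>\<T>. \<exists>y\<in>\<Inter>\<T>. z \<in> ms_supp L (fusion L x y))" for z T
    proof -
      have "bar z \<in> T \<or> (\<exists>x\<in>T. \<exists>y\<in>T. z \<in> ms_supp L (fusion L x y))"
        using z that(2) by blast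
      with \<open>\<forall>T\<in>\<T>. subrule L T\<close> that(1,2) show "z \<in> T"
        using subrule_mem by simp
    qed
    have one: "\<epsilon> \<in> T" if "T \<in> \<T>" for T
      using bspec[OF \<open>\<forall>T\<in>\<T>. subrule L T\<close> that] by (simp add: subrule_def)
    show ?thesis
      unfolding subrule_def
      by (intro conjI ballI impI InterI) (fact that(1), erule one, rule mem)
  qed
  ultimately show ?thesis
    unfolding adjoint_subrule_def by simp
qed

lemma adjoint_contains: "x \<in> carrier L \<Longrightarrow> {x} \<star> {bar x} \<subseteq> adjoint_subrule L"
  by (auto simp: adjoint_subrule_def set_prod_def)

lemma adjoint_least:
  "subrule L T \<Longrightarrow> (\<And>x. x \<in> carrier L \<Longrightarrow> {x} \<star> {bar x} \<subseteq> T) \<Longrightarrow> adjoint_subrule L \<subseteq> T"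
  by (auto simp: adjoint_subrule_def set_prod_def)

lemma subrule_restr_iff:
  assumes "subrule L A" "T \<subseteq> A"
  shows "subrule (restr A) T \<longleftrightarrow> subrule L T"
proof -
  note A = subrule_subset[OF assms(1)]
  have supp: "(\<exists>x\<in>T. \<exists>y\<in>T. z \<in> ms_supp (restr A) (fusion (restr A) x y)) \<longleftrightarrow>
      (\<exists>x\<in>T. \<exists>y\<in>T. z \<in> ms_supp L (fusion L x y))" for z
    using assms(2) by (simp add: subrule_supp[OF assms(1)] subset_iff cong: bex_cong)
  have in_A: "z \<in> A"
    if "z \<in> carrier L" "bar z \<in> T \<or> (\<exists>x\<in>T. \<exists>y\<in>T. z \<in> ms_supp L (fusion L x y))" for z
  proof -
    have "bar z \<in> A \<or> (\<exists>x\<in>A. \<exists>y\<in>A. z \<in> ms_supp L (fusion L x y))"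
      using that(2) assms(2) by blast
    with assms(1) that(1) show ?thesis
      by (rule subrule_mem)
  qed
  have "(\<forall>z\<in>A. fr_bar (restr A) z \<in> T \<or> (\<exists>x\<in>T. \<exists>y\<in>T. z \<in> ms_supp L (fusion L x y)) \<longrightarrow> z \<in> T) \<longleftrightarrow>
      (\<forall>z\<in>A. bar z \<in> T \<or> (\<exists>x\<in>T. \<exists>y\<in>T. z \<in> ms_supp L (fusion L x y)) \<longrightarrow> z \<in> T)"
    by (intro ball_cong) (simp_all add: subrule_bar_eq[OF assms(1)])
  also have "\<dots> \<longleftrightarrow> (\<forall>z\<in>carrier L. bar z \<in> T \<or>
      (\<exists>x\<in>T. \<exists>y\<in>T. z \<in> ms_supp L (fusion L x y)) \<longrightarrow> z \<in> T)"
    using A in_A by (meson subsetD)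
  finally show ?thesis
    using A assms(2) unfolding subrule_def supp subrule_one[OF assms(1)] by auto
qed

end

lemma adjoint_series_fusion_rule:
  assumes "fusion_rule L"
  shows "fusion_rule (adjoint_series L n)"
proof (induction n)
  case (Suc n)
  then interpret fusion_struct "adjoint_series L n" by unfold_locales
  show ?case by (simp add: subrule_fusion_rule[OF subrule_adjoint])
qed (simp add: assms)


context fusion_struct
begin

text \<open>
  The multiplicity of the unit in \<open>a (bar a)\<close> is 1 by duality, so the support decides whether \<open>a\<close> is a simple current.
\<close>

lemma simple_currents_eq: "simple_currents L = {a \<in> carrier L. {a} \<star> {bar a} = {\<epsilon>}}"
proof -
  have "ms_eq L (fusion L a (bar a)) (indicator {\<epsilon>}) \<longleftrightarrow> {a} \<star> {bar a} = {\<epsilon>}"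
    if a: "a \<in> carrier L" for a
  proof
    assume "ms_eq L (fusion L a (bar a)) (indicator {\<epsilon>})"
    then show "{a} \<star> {bar a} = {\<epsilon>}"
      by (simp add: set_prod_def ms_supp_cong[of L _ "indicator {\<epsilon>}"])
  next
    assume 1: "{a} \<star> {bar a} = {\<epsilon>}"
    have "fusion L a (bar a) z = indicator {\<epsilon>} z" if "z \<in> carrier L" for z
    proof (cases "z = \<epsilon>")
      case False
      then have "z \<notin> {a} \<star> {bar a}" using 1 by simp
      then show ?thesis using that False by (simp add: in_sprod)
    qed (simp add: fusion_to_one a)
    then show "ms_eq L (fusion L a (bar a)) (indicator {\<epsilon>})"
      by (simp add: ms_eq_def)
  qed
  then show ?thesis
    unfolding simple_currents_def by (intro Collect_cong conj_cong refl)
qed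

end


section \<open>Invariance under isomorphism\<close>

text \<open>
  The isomorphism itself, rather than its existence, has to be followed through the adjoint series.
\<close>

definition fusion_map :: "('a \<Rightarrow> 'b) \<Rightarrow> ('a, 'm) multimagma_scheme \<Rightarrow> ('b, 'n) multimagma_scheme \<Rightarrow> bool"
  where "fusion_map f L M \<longleftrightarrow> bij_betw f (carrier L) (carrier M) \<and>
    (\<forall>x\<in>carrier L. \<forall>y\<in>carrier L. \<forall>z\<in>carrier L. fusion M (f x) (f y) (f z) = fusion L x y z)"

lemma mm_iso_iff: "mm_iso L M \<longleftrightarrow> (\<exists>f. fusion_map f L M)"
  by (simp add: mm_iso_def fusion_map_def)

lemma fusion_map_id: "fusion_map id L L"
  by (simp add: fusion_map_def)

lemma fusion_map_inv:
  assumes "fusion_map f L M"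
  shows "fusion_map (inv_into (carrier L) f) M L"
proof -
  have f: "bij_betw f (carrier L) (carrier M)" using assms by (simp add: fusion_map_def)
  have "fusion L (inv_into (carrier L) f x) (inv_into (carrier L) f y) (inv_into (carrier L) f z) = fusion M x y z"
    if "x \<in> carrier M" "y \<in> carrier M" "z \<in> carrier M" for x y z
  proof -
    have "inv_into (carrier L) f w \<in> carrier L" "f (inv_into (carrier L) f w) = w" if "w \<in> carrier M" for w
      using f that by (simp_all add: bij_betw_def inv_into_into f_inv_into_f)
    then show ?thesis
      using assms that unfolding fusion_map_def by metis
  qed
  then show ?thesis
    using bij_betw_inv_into[OF f] by (simp add: fusion_map_def)
qed

lemma fusion_map_comp:
  assumes "fusion_map f L M" "fusion_map g M K"
  shows "fusion_map (g \<circ> f) L K"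
proof -
  have "f x \<in> carrier M" if "x \<in> carrier L" for x
    using assms(1) that by (auto simp: fusion_map_def bij_betw_def)
  then show ?thesis
    using assms bij_betw_trans[of f "carrier L" "carrier M" g "carrier K"]
    by (simp add: fusion_map_def)
qed

lemma mm_iso_refl: "mm_iso L L"
  using fusion_map_id mm_iso_iff by blast

lemma mm_iso_sym: "mm_iso L M \<Longrightarrow> mm_iso M L"
  using fusion_map_inv mm_iso_iff by metis

lemma mm_iso_trans: "mm_iso L M \<Longrightarrow> mm_iso M K \<Longrightarrow> mm_iso L K"
  using fusion_map_comp mm_iso_iff by metis

locale fusion_iso = fusion_struct L
  for L :: "('a, 'm) multimagma_scheme" +
  fixes M :: "('b, 'n) multimagma_scheme" and f :: "'a \<Rightarrow> 'b"
  assumes is_map: "fusion_map f L M"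
begin

lemma inj: "inj_on f (carrier L)"
  and surj: "carrier M = f ` carrier L"
  using is_map by (auto simp: fusion_map_def bij_betw_def)

lemma map_eq_iff [simp]: "x \<in> carrier L \<Longrightarrow> y \<in> carrier L \<Longrightarrow> f x = f y \<longleftrightarrow> x = y"
  using inj by (auto simp: inj_on_def)

lemma map_closed [simp]: "x \<in> carrier L \<Longrightarrow> f x \<in> carrier M"
  by (simp add: surj)

lemma fusion_image [simp]:
  "x \<in> carrier L \<Longrightarrow> y \<in> carrier L \<Longrightarrow> z \<in> carrier L \<Longrightarrow> fusion M (f x) (f y) (f z) = fusion L x y z"
  using is_map by (simp add: fusion_map_def)

lemma supp_image:
  assumes "x \<in> carrier L" "y \<in> carrier L"
  shows "ms_supp M (fusion M (f x) (f y)) = f ` ms_supp L (fusion L x y)"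
proof -
  have "ms_supp M (fusion M (f x) (f y)) = {f z |z. z \<in> carrier L \<and> fusion M (f x) (f y) (f z) > 0}"
    unfolding ms_supp_def surj by blast
  also have "\<dots> = {f z |z. z \<in> carrier L \<and> fusion L x y z > 0}"
    using assms by (intro Collect_cong) auto
  finally show ?thesis
    unfolding ms_supp_def by blast
qed

lemma image_unit: "is_unit_elt M (f \<epsilon>)"
  unfolding is_unit_elt_def ms_eq_def surj
  by (simp add: fusion_one indicator_def)

lemma image_dual: "x \<in> carrier L \<Longrightarrow> is_dual_elt M (f \<epsilon>) (f x) (f (bar x))"
  unfolding is_dual_elt_def surj by (simp add: fusion_to_one)

lemma image_fusion_rule: "fusion_rule M"
proof -
  have "locally_finite M"
    unfolding locally_finite_def surj by (simp add: supp_image finite_supp)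
  moreover have "fusion_assoc M"
    unfolding fusion_assoc_def surj
  proof (intro ballI, elim imageE, hypsubst)
    fix x y z v assume C: "x \<in> carrier L" "y \<in> carrier L" "z \<in> carrier L" "v \<in> carrier L"
    have "(\<Sum>w\<in>f ` ms_supp L X. h w) = (\<Sum>w\<in>ms_supp L X. h (f w))" for X and h :: "'b \<Rightarrow> nat"
      using inj_on_subset[OF inj ms_supp_subset] by (simp add: sum.reindex)
    moreover have "w \<in> ms_supp L X \<Longrightarrow> w \<in> carrier L" for w X
      by (simp add: ms_supp_def)
    ultimately show "(\<Sum>w\<in>ms_supp M (fusion M (f x) (f y)). fusion M (f x) (f y) w * fusion M w (f z) (f v)) =
        (\<Sum>w\<in>ms_supp M (fusion M (f y) (f z)). fusion M (f y) (f z) w * fusion M (f x) w (f v))"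
      using C assoc[of x y z v] by (simp add: supp_image)
  qed
  ultimately show ?thesis
    unfolding fusion_rule_iff using image_unit image_dual surj by auto
qed

sublocale M: fusion_struct M
  by unfold_locales (rule image_fusion_rule)

lemma image_one: "fr_one M = f \<epsilon>"
  by (rule fr_one_eq[OF image_unit])

lemma image_bar: "x \<in> carrier L \<Longrightarrow> fr_bar M (f x) = f (bar x)"
  by (rule fr_bar_eq[OF image_unit image_dual])

lemma image_sprod:
  assumes "A \<subseteq> carrier L" "B \<subseteq> carrier L"
  shows "set_prod M (f ` A) (f ` B) = f ` (A \<star> B)"
proof -
  have "set_prod M (f ` A) (f ` B) = (\<Union>x\<in>A. \<Union>y\<in>B. ms_supp M (fusion M (f x) (f y)))"
    by (simp add: set_prod_def)
  also have "\<dots> = (\<Union>x\<in>A. \<Union>y\<in>B. f ` ms_supp L (fusion L x y))"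
    using assms by (intro SUP_cong refl supp_image) auto
  finally show ?thesis
    by (simp add: set_prod_def image_UN)
qed

lemma image_simple_currents: "simple_currents M = f ` simple_currents L"
proof -
  have "set_prod M {f a} {fr_bar M (f a)} = {fr_one M} \<longleftrightarrow> {a} \<star> {bar a} = {\<epsilon>}" if "a \<in> carrier L" for a
  proof -
    have "set_prod M {f a} {fr_bar M (f a)} = f ` ({a} \<star> {bar a})"
      using image_sprod[of "{a}" "{bar a}"] that by (simp add: image_bar)
    moreover have "f ` ({a} \<star> {bar a}) = f ` {\<epsilon>} \<longleftrightarrow> {a} \<star> {bar a} = {\<epsilon>}"
      by (rule inj_on_image_eq_iff[OF inj sprod_closed]) simp
    ultimately show ?thesis by (simp add: image_one)
  qed
  then show ?thesis
    unfolding simple_currents_eq M.simple_currents_eq surj by auto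
qed

lemma image_index:
  assumes "T \<subseteq> carrier L"
  shows "fr_index M (f ` T) = fr_index L T"
proof -
  have "left_coset M (f x) (f ` T) = f ` left_coset L x T" if "x \<in> carrier L" for x
    using image_sprod[of "{x}" T] assms that by (simp add: left_coset_eq)
  then have "(\<lambda>x. left_coset M x (f ` T)) ` carrier M = (`) f ` (\<lambda>x. left_coset L x T) ` carrier L"
    unfolding surj image_image by (intro image_cong refl)
  moreover have "inj_on ((`) f) ((\<lambda>x. left_coset L x T) ` carrier L)"
    by (rule inj_on_subset[OF inj_on_image_Pow[OF inj]]) (auto simp: left_coset_eq in_sprod)
  ultimately show ?thesis
    by (simp add: fr_index_def card_image)
qed

lemma image_subrule:
  assumes T: "subrule L T"
  shows "subrule M (f ` T)"
  unfolding subrule_def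
proof (intro conjI ballI impI)
  show "f ` T \<subseteq> carrier M" using subrule_subset[OF T] by (auto simp: surj)
  show "fr_one M \<in> f ` T" using T by (simp add: image_one subrule_def)
next
  fix z assume z: "z \<in> carrier M"
    and *: "fr_bar M z \<in> f ` T \<or> (\<exists>x\<in>f ` T. \<exists>y\<in>f ` T. z \<in> ms_supp M (fusion M x y))"
  obtain w where w: "w \<in> carrier L" "z = f w" using z by (auto simp: surj)
  have T': "T \<subseteq> carrier L" by (rule subrule_subset[OF T])
  have in_image: "f v \<in> f ` U \<longleftrightarrow> v \<in> U" if "v \<in> carrier L" "U \<subseteq> carrier L" for v U
    by (rule inj_on_image_mem_iff[OF inj that])
  have "f w \<in> ms_supp M (fusion M (f x) (f y)) \<longleftrightarrow> w \<in> ms_supp L (fusion L x y)" if "x \<in> T" "y \<in> T" for x y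
    using supp_image[of x y] in_image[OF w(1) ms_supp_subset] that T' by auto
  then have "bar w \<in> T \<or> (\<exists>x\<in>T. \<exists>y\<in>T. w \<in> ms_supp L (fusion L x y))"
    using * w in_image[OF _ T'] by (auto simp: image_bar)
  from subrule_mem[OF T w(1) this] w show "z \<in> f ` T" by simp
qed

text \<open>Equality follows from this inclusion, applied also to the inverse isomorphism.\<close>

lemma adjoint_subset_image: "adjoint_subrule M \<subseteq> f ` adjoint_subrule L"
proof (rule M.adjoint_least[OF image_subrule[OF subrule_adjoint]])
  fix y assume "y \<in> carrier M"
  then obtain x where "x \<in> carrier L" "y = f x" by (auto simp: surj)
  then show "set_prod M {y} {fr_bar M y} \<subseteq> f ` adjoint_subrule L"
    using image_sprod[of "{x}" "{bar x}"] adjoint_contains[of x] by (auto simp: image_bar)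
qed

lemma restrict_map:
  assumes "T \<subseteq> carrier L"
  shows "fusion_map f (L\<lparr>carrier := T\<rparr>) (M\<lparr>carrier := f ` T\<rparr>)"
  using assms inj_on_subset[OF inj assms] by (auto simp: fusion_map_def bij_betw_def subset_iff)

end

lemma (in fusion_iso) image_adjoint: "adjoint_subrule M = f ` adjoint_subrule L"
proof (rule equalityI[OF adjoint_subset_image])
  define g where "g = inv_into (carrier L) f"
  interpret g: fusion_iso M L g
    using fusion_map_inv[OF is_map] by unfold_locales (simp add: g_def)
  have "f ` adjoint_subrule L \<subseteq> f ` g ` adjoint_subrule M"
    by (intro image_mono g.adjoint_subset_image)
  also have "\<dots> = adjoint_subrule M"
  proof -
    have "f (g y) = y" if "y \<in> adjoint_subrule M" for y
      using that subrule_subset M.subrule_subset[OF M.subrule_adjoint] surj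
      by (auto simp: g_def f_inv_into_f)
    then show ?thesis by (simp add: image_image)
  qed
  finally show "f ` adjoint_subrule L \<subseteq> adjoint_subrule M" .
qed

lemma adjoint_series_map:
  assumes "fusion_rule L" "fusion_map f L M"
  shows "fusion_map f (adjoint_series L n) (adjoint_series M n)"
proof (induction n)
  case (Suc n)
  interpret fusion_iso "adjoint_series L n" "adjoint_series M n" f
    using adjoint_series_fusion_rule[OF assms(1)] Suc by unfold_locales
  show ?case
    using restrict_map[OF subrule_subset[OF subrule_adjoint]] by (simp add: image_adjoint)
qed (simp add: assms)

lemma properly_feudal_iso_invariant:
  assumes "properly_feudal L" "mm_iso L M"
  shows "properly_feudal M"
proof -
  obtain f where f: "fusion_map f L M" using assms(2) mm_iso_iff by blast
  have L: "fusion_rule L" using assms(1) by (simp add: properly_feudal_def)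
  interpret fusion_iso L M f using L f by unfold_locales
  obtain n where "carrier (adjoint_series L n) = {fr_one L}"
    using assms(1) by (auto simp: properly_feudal_def nilpotent_def)
  with adjoint_series_map[OF L f, of n] have "carrier (adjoint_series M n) = {fr_one M}"
    by (auto simp: fusion_map_def bij_betw_def image_one)
  moreover have "fr_index M (simple_currents M) = fr_index L (simple_currents L)"
    unfolding image_simple_currents by (rule image_index) (auto simp: simple_currents_def)
  ultimately show ?thesis
    using assms(1) image_fusion_rule by (auto simp: properly_feudal_def nilpotent_def)
qed


section \<open>Simple currents\<close>

context fusion_struct
begin

abbreviation currents where "currents \<equiv> simple_currents L"

lemma currents_subset: "currents \<subseteq> carrier L"
  by (auto simp: simple_currents_def)

lemma current_bar_right: "a \<in> currents \<Longrightarrow> {a} \<star> {bar a} = {\<epsilon>}"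
  by (simp add: simple_currents_eq)

lemma currentI: "a \<in> carrier L \<Longrightarrow> {a} \<star> {bar a} = {\<epsilon>} \<Longrightarrow> a \<in> currents"
  by (simp add: simple_currents_eq)

lemma currents_carrier [simp]: "a \<in> currents \<Longrightarrow> a \<in> carrier L"
  using currents_subset by auto

lemma supp_eq: "ms_supp L (fusion L x y) = {x} \<star> {y}"
  by (simp add: set_prod_def)

text \<open>
  Every \<open>w\<close> in the support of \<open>(bar a) a\<close> contributes to the multiplicity of \<open>a\<close> in
  \<open>a ((bar a) a) = (a (bar a)) a = a\<close>, which is 1; the unit already accounts for that.
\<close>

lemma current_bar_left:
  assumes "a \<in> currents"
  shows "{bar a} \<star> {a} = {\<epsilon>}"
proof -
  have a: "a \<in> carrier L" using assms by simp
  have "w = \<epsilon>" if w: "w \<in> {bar a} \<star> {a}" for w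
  proof (rule ccontr)
    assume "w \<noteq> \<epsilon>"
    have wL: "w \<in> carrier L" using w by (simp add: in_sprod)
    have "{a} \<star> {w} \<subseteq> {a} \<star> ({bar a} \<star> {a})"
      using w by (intro sprod_mono) auto
    also have "\<dots> = {a}"
      using sprod_assoc[of "{a}" "{bar a}" "{a}"] a current_bar_right[OF assms] by simp
    finally have "a \<in> {a} \<star> {w}"
      using sprod_nonempty[OF a wL] by blast
    then have pos: "fusion L a w a > 0" by (simp add: in_sprod)
    let ?t = "\<lambda>v. fusion L (bar a) a v * fusion L a v a"
    have "1 = (\<Sum>v\<in>ms_supp L (fusion L a (bar a)). fusion L a (bar a) v * fusion L v a a)"
      using a by (simp add: supp_eq current_bar_right[OF assms] fusion_one fusion_to_one)
    also have "\<dots> = (\<Sum>v\<in>ms_supp L (fusion L (bar a) a). ?t v)"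
      by (rule assoc) (use a in simp_all)
    also have "\<dots> \<ge> (\<Sum>v\<in>{\<epsilon>, w}. ?t v)"
      using a w one_in_sprod_bar[OF a] finite_supp[of "bar a" a]
      by (intro sum_mono2) (auto simp: supp_eq)
    finally have "?t \<epsilon> + ?t w \<le> 1"
      using \<open>w \<noteq> \<epsilon>\<close> by simp
    moreover have "?t \<epsilon> = 1" using a by (simp add: fusion_one fusion_to_one)
    moreover have "?t w > 0" using pos w by (simp add: in_sprod)
    ultimately show False by simp
  qed
  then show ?thesis using one_in_sprod_bar[OF a] by blast
qed

lemma current_bar: "a \<in> currents \<Longrightarrow> bar a \<in> currents"
  using current_bar_left by (intro currentI) simp_all

lemma one_current [simp]: "\<epsilon> \<in> currents"
  by (intro currentI) simp_all

lemma current_cancel: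
  assumes "a \<in> currents" "A \<subseteq> carrier L"
  shows "{a} \<star> ({bar a} \<star> A) = A" "{bar a} \<star> ({a} \<star> A) = A"
    "(A \<star> {a}) \<star> {bar a} = A" "(A \<star> {bar a}) \<star> {a} = A"
proof -
  have a: "a \<in> carrier L" using assms by simp
  show "{a} \<star> ({bar a} \<star> A) = A" "{bar a} \<star> ({a} \<star> A) = A"
    using sprod_assoc[of "{a}" "{bar a}" A] sprod_assoc[of "{bar a}" "{a}" A] a assms
      current_bar_right[of a] current_bar_left[of a] by simp_all
  show "(A \<star> {a}) \<star> {bar a} = A" "(A \<star> {bar a}) \<star> {a} = A"
    using sprod_assoc[of A "{a}" "{bar a}"] sprod_assoc[of A "{bar a}" "{a}"] a assms
      current_bar_right[of a] current_bar_left[of a] by simp_all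
qed

text \<open>The product of two elements when it is a single element, as it is if one of them is a simple current.\<close>

definition dot (infixl "\<odot>" 70) where "x \<odot> y = (THE z. {x} \<star> {y} = {z})"

lemma dot_eq: "{x} \<star> {y} = {z} \<Longrightarrow> x \<odot> y = z"
  unfolding dot_def by simp

text \<open>
  For \<open>y\<close> in the support of \<open>ax\<close>, the nonempty support of \<open>(bar a) y\<close> lies in that of \<open>(bar a) a x = x\<close>; multiplying
  by \<open>a\<close> again gives \<open>ax = y\<close>.
\<close>

lemma current_dot_left:
  assumes "a \<in> currents" "x \<in> carrier L"
  shows "{a} \<star> {x} = {a \<odot> x}"
proof -
  obtain y where y: "y \<in> {a} \<star> {x}"
    using sprod_nonempty[of a x] assms by auto
  then have yL: "y \<in> carrier L" by (simp add: in_sprod)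
  have "{bar a} \<star> {y} \<subseteq> {bar a} \<star> ({a} \<star> {x})"
    using y by (intro sprod_mono) auto
  then have "{bar a} \<star> {y} = {x}"
    using sprod_nonempty[of "bar a" y] yL assms by (auto simp: current_cancel)
  then have "{a} \<star> {x} = {y}"
    using current_cancel(1)[of a "{y}"] yL assms by simp
  then show ?thesis by (simp add: dot_eq)
qed

lemma current_dot_right:
  assumes "a \<in> currents" "x \<in> carrier L"
  shows "{x} \<star> {a} = {x \<odot> a}"
proof -
  obtain y where y: "y \<in> {x} \<star> {a}"
    using sprod_nonempty[of x a] assms by auto
  then have yL: "y \<in> carrier L" by (simp add: in_sprod)
  have "{y} \<star> {bar a} \<subseteq> ({x} \<star> {a}) \<star> {bar a}"
    using y by (intro sprod_mono) auto
  then have "{y} \<star> {bar a} = {x}"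
    using sprod_nonempty[of y "bar a"] yL assms by (auto simp: current_cancel)
  then have "{x} \<star> {a} = {y}"
    using current_cancel(4)[of a "{y}"] yL assms by simp
  then show ?thesis by (simp add: dot_eq)
qed

lemma dot_closed [simp]:
  assumes "a \<in> currents" "x \<in> carrier L"
  shows "a \<odot> x \<in> carrier L" "x \<odot> a \<in> carrier L"
  using current_dot_left[OF assms] current_dot_right[OF assms] sprod_closed by blast+

text \<open>
  The multiplicity of \<open>x\<close> in \<open>(bar a) a x = x\<close> is 1, and it is divisible by the multiplicity of \<open>a \<odot> x\<close> in \<open>ax\<close>.
\<close>

lemma fusion_current:
  assumes "a \<in> currents" "x \<in> carrier L" "z \<in> carrier L"
  shows "fusion L a x z = (if z = a \<odot> x then 1 else 0)"
    and "fusion L x a z = (if z = x \<odot> a then 1 else 0)"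
proof -
  have a: "a \<in> carrier L" using assms by simp
  have "fusion L a x (a \<odot> x) * fusion L (bar a) (a \<odot> x) x = 1"
    using assoc[of "bar a" a x x] a assms
    by (simp add: supp_eq current_bar_left current_dot_left fusion_one fusion_to_one)
  moreover have "fusion L a x z = 0" if "z \<noteq> a \<odot> x"
    using current_dot_left[of a x] that assms in_sprod[of z "{a}" "{x}"] by simp
  ultimately show "fusion L a x z = (if z = a \<odot> x then 1 else 0)" by auto
  have "fusion L x a (x \<odot> a) * fusion L (x \<odot> a) (bar a) x = 1"
    using assoc[of x a "bar a" x] a assms
    by (simp add: supp_eq current_bar_right current_dot_right fusion_one fusion_to_one)
  moreover have "fusion L x a z = 0" if "z \<noteq> x \<odot> a"
    using current_dot_right[of a x] that assms in_sprod[of z "{x}" "{a}"] by simp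
  ultimately show "fusion L x a z = (if z = x \<odot> a then 1 else 0)" by auto
qed

text \<open>
  The supports satisfy \<open>(xa)((bar a)(bar x)) = x (bar x)\<close>, and since this contains the unit, \<open>(bar a)(bar x)\<close> is the dual of \<open>xa\<close>.
\<close>

lemma bar_dot_current:
  assumes "a \<in> currents" "x \<in> carrier L"
  shows "bar (x \<odot> a) = bar a \<odot> bar x" "bar (a \<odot> x) = bar x \<odot> bar a"
    and square_dot: "{x \<odot> a} \<star> {bar (x \<odot> a)} = {x} \<star> {bar x}"
proof -
  have sq: "{x \<odot> a} \<star> {bar a \<odot> bar x} = {x} \<star> {bar x}"
    and bar: "bar (x \<odot> a) = bar a \<odot> bar x" if "a \<in> currents" "x \<in> carrier L" for a x
  proof -
    have "{x \<odot> a} \<star> {bar a \<odot> bar x} = ({x} \<star> {a}) \<star> ({bar a} \<star> {bar x})"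
      using that by (simp add: current_dot_right current_dot_left current_bar)
    also have "\<dots> = {x} \<star> ({a} \<star> ({bar a} \<star> {bar x}))"
      using that by (intro sprod_assoc) (auto simp: in_sprod)
    also have "\<dots> = {x} \<star> {bar x}"
      using that by (simp add: current_cancel)
    finally show 1: "{x \<odot> a} \<star> {bar a \<odot> bar x} = {x} \<star> {bar x}" .
    show "bar (x \<odot> a) = bar a \<odot> bar x"
      using bar_eq_sprod[of "x \<odot> a" "bar a \<odot> bar x"] 1 that one_in_sprod_bar[of x]
      by (simp add: current_bar)
  qed
  show "bar (x \<odot> a) = bar a \<odot> bar x" by (rule bar[OF assms])
  show "{x \<odot> a} \<star> {bar (x \<odot> a)} = {x} \<star> {bar x}" by (simp add: sq bar assms)
  have "bar (bar x \<odot> bar a) = a \<odot> x"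
    using bar[of "bar a" "bar x"] assms by (simp add: current_bar)
  then have "bar (bar (bar x \<odot> bar a)) = bar (a \<odot> x)" by simp
  then show "bar (a \<odot> x) = bar x \<odot> bar a"
    using assms by (simp add: current_bar)
qed

lemma current_dot [simp]: "a \<in> currents \<Longrightarrow> b \<in> currents \<Longrightarrow> a \<odot> b \<in> currents"
  using square_dot[of b a] current_bar_right[of a] by (intro currentI) simp_all

lemma dot_assoc:
  assumes "{x} \<star> {y} = {x \<odot> y}" "{y} \<star> {z} = {y \<odot> z}" "{x \<odot> y} \<star> {z} = {(x \<odot> y) \<odot> z}"
    "x \<in> carrier L" "y \<in> carrier L" "z \<in> carrier L"
  shows "(x \<odot> y) \<odot> z = x \<odot> (y \<odot> z)"
proof -
  have "{x} \<star> {y \<odot> z} = {(x \<odot> y) \<odot> z}"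
    using sprod_assoc[of "{x}" "{y}" "{z}"] assms(4-6) unfolding assms(1-3) by simp
  from dot_eq[OF this] show ?thesis by (rule sym)
qed

lemma dot_one [simp]: "x \<in> carrier L \<Longrightarrow> \<epsilon> \<odot> x = x" "x \<in> carrier L \<Longrightarrow> x \<odot> \<epsilon> = x"
  by (simp_all add: dot_eq)

lemma current_dot_bar [simp]:
  "a \<in> currents \<Longrightarrow> bar a \<odot> a = \<epsilon>" "a \<in> currents \<Longrightarrow> a \<odot> bar a = \<epsilon>"
  by (simp_all add: dot_eq current_bar_left current_bar_right)

lemma dot_cancel:
  assumes "a \<in> currents" "x \<in> carrier L"
  shows "bar a \<odot> (a \<odot> x) = x" "(x \<odot> a) \<odot> bar a = x"
  using current_cancel(2)[of a "{x}"] current_cancel(3)[of a "{x}"] assms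
  by (simp_all add: current_dot_left current_dot_right current_bar)

definition current_group where
  "current_group = \<lparr>carrier = currents, mult = (\<odot>), one = \<epsilon>\<rparr>"

lemma current_group: "group current_group"
proof (rule groupI)
  fix a b c assume "a \<in> carrier current_group" "b \<in> carrier current_group" "c \<in> carrier current_group"
  then show "a \<otimes>\<^bsub>current_group\<^esub> b \<otimes>\<^bsub>current_group\<^esub> c =
      a \<otimes>\<^bsub>current_group\<^esub> (b \<otimes>\<^bsub>current_group\<^esub> c)"
    using dot_assoc[of a b c] by (simp add: current_group_def current_dot_left)
next
  fix a assume "a \<in> carrier current_group"
  then show "\<exists>b\<in>carrier current_group. b \<otimes>\<^bsub>current_group\<^esub> a = \<one>\<^bsub>current_group\<^esub>"
    using current_bar[of a] current_dot_bar(1)[of a] by (intro bexI[of _ "bar a"]) (simp_all add: current_group_def)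
qed (simp_all add: current_group_def)

end


context fusion_struct
begin

lemma subrule_currents: "subrule L currents"
  unfolding subrule_def
proof (intro conjI ballI impI currents_subset one_current)
  fix z assume z: "z \<in> carrier L"
    and "bar z \<in> currents \<or> (\<exists>x\<in>currents. \<exists>y\<in>currents. z \<in> ms_supp L (fusion L x y))"
  then show "z \<in> currents"
    using current_bar[of "bar z"] current_dot by (auto simp: supp_eq current_dot_left)
qed

lemma subrule_one_set: "subrule L {\<epsilon>}"
  unfolding subrule_def
proof (intro conjI ballI impI)
  fix z assume z: "z \<in> carrier L"
    and "bar z \<in> {\<epsilon>} \<or> (\<exists>x\<in>{\<epsilon>}. \<exists>y\<in>{\<epsilon>}. z \<in> ms_supp L (fusion L x y))"
  then have "bar z = \<epsilon> \<or> z = \<epsilon>" by (simp add: supp_eq)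
  then show "z \<in> {\<epsilon>}" using bar_bar[OF z] bar_one by (metis singletonI)
qed simp_all

end

text \<open>
  The adjoint subrule lies in the subrule of simple currents, and products \<open>a (bar a)\<close> of simple currents
  are trivial: the series reaches the unit after two steps.
\<close>

lemma nilpotentI:
  fixes L :: "'a multimagma"
  assumes "fusion_rule L"
    and sq: "\<And>x. x \<in> carrier L \<Longrightarrow> set_prod L {x} {fr_bar L x} \<subseteq> simple_currents L"
  shows "nilpotent L"
proof -
  interpret fusion_struct L by unfold_locales (rule assms(1))
  let ?A = "adjoint_subrule L"
  have A: "subrule L ?A" by (rule subrule_adjoint)
  have Ac: "?A \<subseteq> currents" by (rule adjoint_least[OF subrule_currents sq])
  interpret A: fusion_struct "restr ?A" by unfold_locales (rule subrule_fusion_rule[OF A])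
  have "subrule (restr ?A) {\<epsilon>}"
    using subrule_restr_iff[OF A, of "{\<epsilon>}"] subrule_one_set subrule_one_mem[OF A] by simp
  moreover have "set_prod (restr ?A) {x} {fr_bar (restr ?A) x} \<subseteq> {\<epsilon>}" if "x \<in> ?A" for x
  proof -
    have "set_prod (restr ?A) {x} {fr_bar (restr ?A) x} = {x} \<star> {bar x}"
      using that by (simp add: set_prod_def subrule_bar_eq[OF A] subrule_supp[OF A] subrule_bar[OF A])
    then show ?thesis using Ac that by (auto simp: current_bar_right)
  qed
  ultimately have "adjoint_subrule (restr ?A) \<subseteq> {\<epsilon>}"
    by (intro A.adjoint_least) simp_all
  moreover have "\<epsilon> \<in> adjoint_subrule (restr ?A)"
    using A.subrule_one_mem[OF A.subrule_adjoint] subrule_one[OF A] by simp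
  ultimately have "carrier (adjoint_series L (Suc (Suc 0))) = {\<epsilon>}" by auto
  then show ?thesis unfolding nilpotent_def by blast
qed


section \<open>The fusion rule of a group homomorphism\<close>

lemma sum_indicator_singleton:
  assumes "finite A" "inj_on f A"
  shows "(\<Sum>t\<in>A. indicator {f t} v) = (indicator (f ` A) v :: nat)"
proof -
  have "(\<Sum>t\<in>A. indicator {f t} v) = (\<Sum>w\<in>f ` A. indicator {w} v :: nat)"
    using assms by (simp add: sum.reindex)
  also have "\<dots> = (\<Sum>w\<in>f ` A. if w = v then 1 else 0)"
    by (intro sum.cong) (auto simp: indicator_def)
  also have "\<dots> = indicator (f ` A) v"
    using assms by (simp add: indicator_def)
  finally show ?thesis .
qed

locale feudal_hom_data =
  fixes S :: "'s monoid" and G :: "'g monoid" and u :: "'s \<Rightarrow> 'g"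
  assumes feudal_hom: "feudal_hom (S, G, u)"
begin

sublocale S: group S using feudal_hom by (simp add: feudal_hom_def)
sublocale G: group G using feudal_hom by (simp add: feudal_hom_def)
sublocale group_hom S G u
  using feudal_hom by unfold_locales (simp add: feudal_hom_def)

abbreviation H where "H \<equiv> u ` carrier S"
definition R where "R = carrier G - H"
abbreviation M where "M \<equiv> feudal_of_hom (S, G, u)"
abbreviation K where "K \<equiv> kernel S G u"
definition fib where "fib y = {s \<in> carrier S. u s = y}"

lemma H: "subgroup H G" by (rule img_is_subgroup)

lemma R_carrier [simp]: "g \<in> R \<Longrightarrow> g \<in> carrier G"
  by (simp add: R_def)

lemma R_iff: "g \<in> carrier G \<Longrightarrow> g \<in> R \<longleftrightarrow> g \<notin> H"
  by (simp add: R_def)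

lemma R_mult_H:
  assumes "g \<in> R" "s \<in> carrier S"
  shows "g \<otimes>\<^bsub>G\<^esub> u s \<in> R" "u s \<otimes>\<^bsub>G\<^esub> g \<in> R"
proof -
  have gs: "g \<in> carrier G" "u s \<in> carrier G" "u s \<in> H" "inv\<^bsub>G\<^esub> u s \<in> H"
    using assms subgroup.m_inv_closed[OF H] by auto
  have "g \<otimes>\<^bsub>G\<^esub> u s \<otimes>\<^bsub>G\<^esub> inv\<^bsub>G\<^esub> u s = g" "inv\<^bsub>G\<^esub> u s \<otimes>\<^bsub>G\<^esub> (u s \<otimes>\<^bsub>G\<^esub> g) = g"
    using gs by (simp_all add: G.m_assoc G.inv_solve_left')
  then show "g \<otimes>\<^bsub>G\<^esub> u s \<in> R" "u s \<otimes>\<^bsub>G\<^esub> g \<in> R"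
    using gs assms(1) subgroup.m_closed[OF H] by (metis R_iff G.m_closed)+
qed

lemma R_inv: "g \<in> R \<Longrightarrow> inv\<^bsub>G\<^esub> g \<in> R"
  using subgroup.m_inv_closed[OF H, of "inv\<^bsub>G\<^esub> g"] by (auto simp: R_def)

text \<open>For \<open>g, h \<in> R\<close> the cosets \<open>Hg\<close> and \<open>Hh\<inverse>\<close> both differ from \<open>H\<close>, hence agree.\<close>

lemma R_mult_R:
  assumes "g \<in> R" "h \<in> R"
  shows "g \<otimes>\<^bsub>G\<^esub> h \<in> H"
proof -
  have "card (rcosets\<^bsub>G\<^esub> H) = 2" using feudal_hom by (simp add: feudal_hom_def)
  then obtain A B where AB: "rcosets\<^bsub>G\<^esub> H = {A, B}" by (auto simp: card_2_iff)
  have *: "H \<in> rcosets\<^bsub>G\<^esub> H" by (rule subgroup.subgroup_in_rcosets[OF H G.is_group])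
  have **: "H #>\<^bsub>G\<^esub> x \<in> rcosets\<^bsub>G\<^esub> H" "H #>\<^bsub>G\<^esub> x \<noteq> H" if "x \<in> R" for x
    using that G.rcosetsI[OF subgroup.subset[OF H], of x] G.rcos_self[OF _ H, of x]
    by (auto simp: R_def)
  have "H #>\<^bsub>G\<^esub> g = H #>\<^bsub>G\<^esub> inv\<^bsub>G\<^esub> h"
    using * **[OF assms(1)] **[OF R_inv[OF assms(2)]] unfolding AB by (elim insertE emptyE) simp_all
  then have "g \<in> H #>\<^bsub>G\<^esub> inv\<^bsub>G\<^esub> h"
    using G.rcos_self[OF _ H, of g] assms by auto
  then obtain k where k: "k \<in> H" "g = k \<otimes>\<^bsub>G\<^esub> inv\<^bsub>G\<^esub> h" by (auto simp: r_coset_def)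
  then have "g \<otimes>\<^bsub>G\<^esub> h = k"
    using assms subgroup.subset[OF H] by (auto simp: G.m_assoc)
  with k show ?thesis by simp
qed

lemma R_nonempty: "R \<noteq> {}"
proof
  assume "R = {}"
  then have "carrier G = H" using subgroup.subset[OF H] by (auto simp: R_def)
  then have "rcosets\<^bsub>G\<^esub> H \<subseteq> {H}"
    using G.coset_join2[OF _ H] by (auto simp: RCOSETS_def)
  from card_mono[OF _ this] feudal_hom show False by (simp add: feudal_hom_def)
qed

lemma fib_shift:
  assumes "s \<in> carrier S" "y \<in> carrier G"
  shows "(\<lambda>t. s \<otimes>\<^bsub>S\<^esub> t) ` fib y = fib (u s \<otimes>\<^bsub>G\<^esub> y)" "(\<lambda>t. t \<otimes>\<^bsub>S\<^esub> s) ` fib y = fib (y \<otimes>\<^bsub>G\<^esub> u s)"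
proof -
  have "t \<in> (\<lambda>t. s \<otimes>\<^bsub>S\<^esub> t) ` fib y" if "t \<in> fib (u s \<otimes>\<^bsub>G\<^esub> y)" for t
    using that assms
    by (intro image_eqI[of _ _ "inv\<^bsub>S\<^esub> s \<otimes>\<^bsub>S\<^esub> t"]) (auto simp: fib_def S.m_assoc[symmetric] G.m_assoc[symmetric])
  then show "(\<lambda>t. s \<otimes>\<^bsub>S\<^esub> t) ` fib y = fib (u s \<otimes>\<^bsub>G\<^esub> y)"
    using assms by (auto simp: fib_def)
  have "t \<in> (\<lambda>t. t \<otimes>\<^bsub>S\<^esub> s) ` fib y" if "t \<in> fib (y \<otimes>\<^bsub>G\<^esub> u s)" for t
    using that assms
    by (intro image_eqI[of _ _ "t \<otimes>\<^bsub>S\<^esub> inv\<^bsub>S\<^esub> s"]) (auto simp: fib_def S.m_assoc G.m_assoc)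
  then show "(\<lambda>t. t \<otimes>\<^bsub>S\<^esub> s) ` fib y = fib (y \<otimes>\<^bsub>G\<^esub> u s)"
    using assms by (auto simp: fib_def)
qed

lemma fib_one: "fib \<one>\<^bsub>G\<^esub> = K"
  by (simp add: fib_def kernel_def)

lemma fib_card:
  assumes "y \<in> H"
  shows "finite (fib y)" "card (fib y) = card K"
proof -
  obtain s where s: "s \<in> carrier S" "y = u s" using assms by blast
  have "fib y = (\<lambda>t. s \<otimes>\<^bsub>S\<^esub> t) ` K"
    using fib_shift(1)[of s "\<one>\<^bsub>G\<^esub>"] s by (simp add: fib_one)
  moreover have "inj_on (\<lambda>t. s \<otimes>\<^bsub>S\<^esub> t) K"
    using s by (auto simp: inj_on_def kernel_def)
  moreover have "finite K" using feudal_hom by (simp add: feudal_hom_def)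
  ultimately show "finite (fib y)" "card (fib y) = card K"
    by (simp_all add: card_image)
qed

lemma carrier_M: "carrier M = Inl ` carrier S \<union> Inr ` R"
  by (simp add: feudal_of_hom_def R_def)

lemma carrier_M_iff [simp]: "Inl s \<in> carrier M \<longleftrightarrow> s \<in> carrier S" "Inr g \<in> carrier M \<longleftrightarrow> g \<in> R"
  by (auto simp: carrier_M)

lemma fusion_M [simp]:
  "fusion M (Inl s) (Inl t) = indicator {Inl (s \<otimes>\<^bsub>S\<^esub> t)}"
  "fusion M (Inl s) (Inr g) = indicator {Inr (u s \<otimes>\<^bsub>G\<^esub> g)}"
  "fusion M (Inr g) (Inl s) = indicator {Inr (g \<otimes>\<^bsub>G\<^esub> u s)}"
  "fusion M (Inr g) (Inr h) = indicator (Inl ` fib (g \<otimes>\<^bsub>G\<^esub> h))"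
  by (simp_all add: feudal_of_hom_def fib_def)

lemma M_cases:
  assumes "x \<in> carrier M"
  obtains s where "x = Inl s" "s \<in> carrier S" | g where "x = Inr g" "g \<in> R"
  using assms unfolding carrier_M by blast

lemma supp_indicator: "A \<subseteq> carrier M \<Longrightarrow> ms_supp M (indicator A) = A"
  by (auto simp: ms_supp_def indicator_def split: if_splits)

lemma supp_M [simp]:
  "s \<in> carrier S \<Longrightarrow> ms_supp M (indicator {Inl s}) = {Inl s}"
  "g \<in> R \<Longrightarrow> ms_supp M (indicator {Inr g}) = {Inr g}"
  "ms_supp M (indicator (Inl ` fib y)) = Inl ` fib y"
  by (rule supp_indicator; auto simp: fib_def)+

text \<open>
  The one case with multiplicities is that of three elements of \<open>R\<close>.  In both ways of bracketing, only their
  product in \<open>G\<close> occurs, with multiplicity the size of a fibre of \<open>u\<close>; all nonempty fibres are as large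
  as the kernel.
\<close>

lemma assoc_M: "fusion_assoc M"
  unfolding fusion_assoc_def
proof (intro ballI)
  fix x y z v assume x: "x \<in> carrier M" and y: "y \<in> carrier M" and z: "z \<in> carrier M"
  show "(\<Sum>w\<in>ms_supp M (fusion M x y). fusion M x y w * fusion M w z v) =
    (\<Sum>w\<in>ms_supp M (fusion M y z). fusion M y z w * fusion M x w v)"
    using x
  proof (cases rule: M_cases)
    case x: (1 s)
    show ?thesis using y
    proof (cases rule: M_cases)
      case y: (1 t)
      show ?thesis using z
        by (cases rule: M_cases) (simp_all add: x y R_mult_H S.m_assoc G.m_assoc)
    next
      case y: (2 g)
      show ?thesis using z
      proof (cases rule: M_cases)
        case z: (1 t)
        then show ?thesis using x y R_mult_H[of g] by (simp add: G.m_assoc)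
      next
        case z: (2 h)
        have gh: "g \<otimes>\<^bsub>G\<^esub> h \<in> H" using R_mult_R y z by simp
        have "(\<Sum>t\<in>fib (g \<otimes>\<^bsub>G\<^esub> h). indicator {Inl (s \<otimes>\<^bsub>S\<^esub> t)} v) =
            (indicator ((\<lambda>t. Inl (s \<otimes>\<^bsub>S\<^esub> t)) ` fib (g \<otimes>\<^bsub>G\<^esub> h)) v :: nat)"
          using fib_card(1)[OF gh] x(2) by (intro sum_indicator_singleton) (auto simp: inj_on_def fib_def)
        also have "(\<lambda>t. Inl (s \<otimes>\<^bsub>S\<^esub> t)) ` fib (g \<otimes>\<^bsub>G\<^esub> h) = Inl ` fib (u s \<otimes>\<^bsub>G\<^esub> (g \<otimes>\<^bsub>G\<^esub> h))"
          using fib_shift(1)[OF x(2), of "g \<otimes>\<^bsub>G\<^esub> h", symmetric] y z by (simp add: image_image)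
        finally show ?thesis
          using x y z R_mult_H[of g s] by (simp add: sum.reindex G.m_assoc)
      qed
    qed
  next
    case x: (2 g)
    show ?thesis using y
    proof (cases rule: M_cases)
      case y: (1 t)
      show ?thesis using z
        by (cases rule: M_cases) (use x y in \<open>simp_all add: R_mult_H G.m_assoc\<close>)
    next
      case y: (2 h)
      have gh: "g \<otimes>\<^bsub>G\<^esub> h \<in> H" using R_mult_R x y by simp
      show ?thesis using z
      proof (cases rule: M_cases)
        case z: (1 s)
        have "(\<Sum>t\<in>fib (g \<otimes>\<^bsub>G\<^esub> h). indicator {Inl (t \<otimes>\<^bsub>S\<^esub> s)} v) =
            (indicator ((\<lambda>t. Inl (t \<otimes>\<^bsub>S\<^esub> s)) ` fib (g \<otimes>\<^bsub>G\<^esub> h)) v :: nat)"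
          using fib_card(1)[OF gh] z(2) by (intro sum_indicator_singleton) (auto simp: inj_on_def fib_def)
        also have "(\<lambda>t. Inl (t \<otimes>\<^bsub>S\<^esub> s)) ` fib (g \<otimes>\<^bsub>G\<^esub> h) = Inl ` fib ((g \<otimes>\<^bsub>G\<^esub> h) \<otimes>\<^bsub>G\<^esub> u s)"
          using fib_shift(2)[OF z(2), of "g \<otimes>\<^bsub>G\<^esub> h", symmetric] x y by (simp add: image_image)
        finally show ?thesis
          using x y z R_mult_H[of h s] by (simp add: sum.reindex G.m_assoc)
      next
        case z: (2 k)
        have hk: "h \<otimes>\<^bsub>G\<^esub> k \<in> H" using R_mult_R y z by simp
        have "(\<Sum>t\<in>fib (g \<otimes>\<^bsub>G\<^esub> h). indicator {Inr (u t \<otimes>\<^bsub>G\<^esub> k)} v) =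
            (\<Sum>t\<in>fib (g \<otimes>\<^bsub>G\<^esub> h). indicator {Inr (g \<otimes>\<^bsub>G\<^esub> h \<otimes>\<^bsub>G\<^esub> k)} v :: nat)"
          by (rule sum.cong) (auto simp: fib_def)
        also have "\<dots> = (\<Sum>t\<in>fib (h \<otimes>\<^bsub>G\<^esub> k). indicator {Inr (g \<otimes>\<^bsub>G\<^esub> h \<otimes>\<^bsub>G\<^esub> k)} v)"
          using fib_card(2)[OF gh] fib_card(2)[OF hk] by simp
        also have "\<dots> = (\<Sum>t\<in>fib (h \<otimes>\<^bsub>G\<^esub> k). indicator {Inr (g \<otimes>\<^bsub>G\<^esub> u t)} v)"
          using x y z by (intro sum.cong) (auto simp: fib_def G.m_assoc)
        finally show ?thesis
          using x y z by (simp add: sum.reindex)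
      qed
    qed
  qed
qed

lemma unit_M: "is_unit_elt M (Inl \<one>\<^bsub>S\<^esub>)"
  unfolding is_unit_elt_def
proof (intro conjI ballI)
  fix x assume "x \<in> carrier M"
  then show "ms_eq M (fusion M (Inl \<one>\<^bsub>S\<^esub>) x) (indicator {x})" "ms_eq M (fusion M x (Inl \<one>\<^bsub>S\<^esub>)) (indicator {x})"
    by (cases rule: M_cases; simp add: ms_eq_def)+
qed simp

lemma dual_M:
  "s \<in> carrier S \<Longrightarrow> is_dual_elt M (Inl \<one>\<^bsub>S\<^esub>) (Inl s) (Inl (inv\<^bsub>S\<^esub> s))"
  "g \<in> R \<Longrightarrow> is_dual_elt M (Inl \<one>\<^bsub>S\<^esub>) (Inr g) (Inr (inv\<^bsub>G\<^esub> g))"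
proof -
  assume s: "s \<in> carrier S"
  have eq: "\<one>\<^bsub>S\<^esub> = s \<otimes>\<^bsub>S\<^esub> t \<longleftrightarrow> t = inv\<^bsub>S\<^esub> s" "\<one>\<^bsub>S\<^esub> = t \<otimes>\<^bsub>S\<^esub> s \<longleftrightarrow> t = inv\<^bsub>S\<^esub> s" if "t \<in> carrier S" for t
    using s that by (metis S.inv_equality S.inv_comm S.l_inv)+
  show "is_dual_elt M (Inl \<one>\<^bsub>S\<^esub>) (Inl s) (Inl (inv\<^bsub>S\<^esub> s))"
    unfolding is_dual_elt_def
  proof (intro conjI ballI)
    fix y assume "y \<in> carrier M"
    then show "fusion M (Inl s) y (Inl \<one>\<^bsub>S\<^esub>) = (if y = Inl (inv\<^bsub>S\<^esub> s) then 1 else 0)"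
      "fusion M y (Inl s) (Inl \<one>\<^bsub>S\<^esub>) = (if y = Inl (inv\<^bsub>S\<^esub> s) then 1 else 0)"
      by (cases rule: M_cases; simp add: indicator_def eq)+
  qed (simp add: s)
next
  assume g: "g \<in> R"
  have "\<one>\<^bsub>G\<^esub> = g \<otimes>\<^bsub>G\<^esub> h \<longleftrightarrow> h = inv\<^bsub>G\<^esub> g" "\<one>\<^bsub>G\<^esub> = h \<otimes>\<^bsub>G\<^esub> g \<longleftrightarrow> h = inv\<^bsub>G\<^esub> g" if "h \<in> carrier G" for h
    using R_carrier[OF g] that by (metis G.inv_equality G.inv_comm G.l_inv)+
  then have eq: "Inl \<one>\<^bsub>S\<^esub> \<in> Inl ` fib (g \<otimes>\<^bsub>G\<^esub> h) \<longleftrightarrow> h = inv\<^bsub>G\<^esub> g"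
    "Inl \<one>\<^bsub>S\<^esub> \<in> Inl ` fib (h \<otimes>\<^bsub>G\<^esub> g) \<longleftrightarrow> h = inv\<^bsub>G\<^esub> g" if "h \<in> R" for h
    using that by (simp_all add: inj_image_mem_iff fib_def)
  show "is_dual_elt M (Inl \<one>\<^bsub>S\<^esub>) (Inr g) (Inr (inv\<^bsub>G\<^esub> g))"
    unfolding is_dual_elt_def
  proof (intro conjI ballI)
    fix y assume "y \<in> carrier M"
    then show "fusion M (Inr g) y (Inl \<one>\<^bsub>S\<^esub>) = (if y = Inr (inv\<^bsub>G\<^esub> g) then 1 else 0)"
      "fusion M y (Inr g) (Inl \<one>\<^bsub>S\<^esub>) = (if y = Inr (inv\<^bsub>G\<^esub> g) then 1 else 0)"
      by (cases rule: M_cases; simp add: indicator_def eq)+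
  qed (simp add: g R_inv)
qed

lemma fusion_rule_M: "fusion_rule M"
proof -
  have "locally_finite M"
    unfolding locally_finite_def
  proof (intro ballI)
    fix x y assume "x \<in> carrier M" "y \<in> carrier M"
    then show "finite (ms_supp M (fusion M x y))"
      by (elim M_cases) (simp_all add: R_mult_H fib_card R_mult_R)
  qed
  moreover have "\<exists>b. is_dual_elt M (Inl \<one>\<^bsub>S\<^esub>) x b" if "x \<in> carrier M" for x
    using that by (cases rule: M_cases) (use dual_M in blast)+
  ultimately show ?thesis
    unfolding fusion_rule_iff using assoc_M unit_M by blast
qed

sublocale M: fusion_struct M
  by unfold_locales (rule fusion_rule_M)

lemma one_M: "fr_one M = Inl \<one>\<^bsub>S\<^esub>"
  by (rule fr_one_eq[OF unit_M])

lemma bar_M: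
  "s \<in> carrier S \<Longrightarrow> fr_bar M (Inl s) = Inl (inv\<^bsub>S\<^esub> s)"
  "g \<in> R \<Longrightarrow> fr_bar M (Inr g) = Inr (inv\<^bsub>G\<^esub> g)"
  by (rule fr_bar_eq[OF unit_M], erule dual_M)+

lemma square_M:
  "s \<in> carrier S \<Longrightarrow> set_prod M {Inl s} {fr_bar M (Inl s)} = {Inl \<one>\<^bsub>S\<^esub>}"
  "g \<in> R \<Longrightarrow> set_prod M {Inr g} {fr_bar M (Inr g)} = Inl ` K"
  by (simp_all add: bar_M set_prod_def flip: fib_one)

lemma simple_currents_M: "simple_currents M = Inl ` carrier S"
proof -
  have K: "K \<noteq> {\<one>\<^bsub>S\<^esub>}" using feudal_hom by (simp add: feudal_hom_def)
  have "Inl ` K \<noteq> (Inl ` {\<one>\<^bsub>S\<^esub>} :: ('s + 'g) set)"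
    using K by (simp only: inj_image_eq_iff[OF inj_Inl] not_False_eq_True)
  then show ?thesis
    unfolding M.simple_currents_eq by (auto simp: carrier_M square_M one_M)
qed

lemma index_M: "fr_index M (simple_currents M) = 2"
proof -
  have l: "left_coset M (Inl s) (Inl ` carrier S) = Inl ` carrier S" if s: "s \<in> carrier S" for s
  proof -
    have "left_coset M (Inl s) (Inl ` carrier S) = Inl ` (\<lambda>t. s \<otimes>\<^bsub>S\<^esub> t) ` carrier S"
      using s by (auto simp: left_coset_def)
    then show ?thesis using S.surj_const_mult[OF s] by simp
  qed
  have r: "left_coset M (Inr g) (Inl ` carrier S) = Inr ` R" if g: "g \<in> R" for g
  proof -
    have "h \<in> (\<lambda>t. g \<otimes>\<^bsub>G\<^esub> u t) ` carrier S" if h: "h \<in> R" for h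
    proof -
      obtain t where t: "t \<in> carrier S" "inv\<^bsub>G\<^esub> g \<otimes>\<^bsub>G\<^esub> h = u t"
        using R_mult_R[OF R_inv[OF g] h] by auto
      have "h = g \<otimes>\<^bsub>G\<^esub> u t"
        using g h by (simp add: t(2)[symmetric] G.m_assoc[symmetric])
      then show ?thesis using t by blast
    qed
    then have "(\<lambda>t. g \<otimes>\<^bsub>G\<^esub> u t) ` carrier S = R"
      using R_mult_H(1)[OF g] by auto
    moreover have "left_coset M (Inr g) (Inl ` carrier S) = Inr ` (\<lambda>t. g \<otimes>\<^bsub>G\<^esub> u t) ` carrier S"
      using R_mult_H(1)[OF g] by (auto simp: left_coset_def)
    ultimately show ?thesis by simp
  qed
  have "(\<lambda>x. left_coset M x (Inl ` carrier S)) ` carrier M =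
      (\<lambda>s. Inl ` carrier S) ` carrier S \<union> (\<lambda>g. Inr ` R) ` R"
    unfolding carrier_M image_Un image_image by (simp add: l r cong: image_cong)
  also have "\<dots> = {Inl ` carrier S, Inr ` R}"
    using S.one_closed R_nonempty by (auto simp: image_constant_conv)
  finally have "(\<lambda>x. left_coset M x (Inl ` carrier S)) ` carrier M = {Inl ` carrier S, Inr ` R}" .
  moreover have "(Inl ` carrier S :: ('s + 'g) set) \<noteq> Inr ` R"
    using S.one_closed by blast
  ultimately show ?thesis
    by (simp add: fr_index_def simple_currents_M)
qed

lemma properly_feudal_M: "properly_feudal M"
proof -
  have "set_prod M {x} {fr_bar M x} \<subseteq> simple_currents M" if "x \<in> carrier M" for x
    using that by (cases rule: M_cases) (auto simp: square_M simple_currents_M kernel_def)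
  then show ?thesis
    using nilpotentI[OF fusion_rule_M] fusion_rule_M index_M by (simp add: properly_feudal_def)
qed

end


section \<open>Properly feudal fusion rules come from group homomorphisms\<close>

text \<open>
  The elements that are not simple currents are called nobles; by the index condition they form a single coset.
\<close>

locale feudal_struct = fusion_struct L for L :: "'a multimagma" +
  assumes nilpotent: "nilpotent L"
    and index_2: "fr_index L currents = 2"
begin

abbreviation nobles where "nobles \<equiv> carrier L - currents"

lemma coset_current:
  assumes "a \<in> currents"
  shows "{a} \<star> currents = currents"
proof
  show "{a} \<star> currents \<subseteq> currents"
  proof
    fix z assume "z \<in> {a} \<star> currents"
    then obtain b where "b \<in> currents" "z \<in> {a} \<star> {b}"
      by (auto elim: sprodE)
    then show "z \<in> currents" using assms by (simp add: current_dot_left)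
  qed
  show "currents \<subseteq> {a} \<star> currents"
  proof
    fix b assume b: "b \<in> currents"
    have "b \<in> {a} \<star> {bar a \<odot> b}"
      using current_cancel(1)[of a "{b}"] assms b by (simp add: current_dot_left current_bar)
    then show "b \<in> {a} \<star> currents"
      using sprod_mono[of "{a}" "{a}" "{bar a \<odot> b}" currents] assms b by (auto simp: current_bar)
  qed
qed

lemma mem_coset: "x \<in> carrier L \<Longrightarrow> x \<in> {x} \<star> currents"
  using sprod_mono[of "{x}" "{x}" "{\<epsilon>}" currents] by auto

lemma coset_noble:
  assumes "x \<in> nobles" "y \<in> nobles"
  shows "{x} \<star> currents = {y} \<star> currents"
proof -
  let ?C = "(\<lambda>x. {x} \<star> currents) ` carrier L"
  have "card ?C = 2" using index_2 by (simp add: fr_index_def left_coset_eq)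
  then obtain A B where AB: "?C = {A, B}" by (auto simp: card_2_iff)
  have "{z} \<star> currents \<in> ?C" "{z} \<star> currents \<noteq> currents" if "z \<in> nobles" for z
    using mem_coset[of z] that by auto
  moreover have "currents \<in> ?C"
    using coset_current[of \<epsilon>] by (intro image_eqI[of _ _ \<epsilon>]) auto
  ultimately show ?thesis
    using assms unfolding AB by blast
qed

lemma nobles_nonempty: "nobles \<noteq> {}"
proof
  assume "nobles = {}"
  then have "(\<lambda>x. {x} \<star> currents) ` carrier L \<subseteq> {currents}"
    using coset_current by auto
  from card_mono[OF _ this] index_2 show False
    by (simp add: fr_index_def left_coset_eq)
qed

lemma noble_transitive:
  assumes "x \<in> nobles" "y \<in> nobles"
  shows "\<exists>a\<in>currents. y = x \<odot> a"
proof -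
  have "y \<in> {x} \<star> currents"
    using coset_noble[OF assms] mem_coset[of y] assms by simp
  then obtain a where "a \<in> currents" "y \<in> {x} \<star> {a}"
    by (auto elim: sprodE)
  then show ?thesis using assms by (auto simp: current_dot_right)
qed

lemma noble_bar: "x \<in> nobles \<Longrightarrow> bar x \<in> nobles"
  using current_bar[of "bar x"] by auto

lemma noble_dot:
  assumes "x \<in> nobles" "a \<in> currents"
  shows "x \<odot> a \<in> nobles" "a \<odot> x \<in> nobles"
proof -
  have 1: "x \<odot> a \<in> nobles" if "x \<in> nobles" "a \<in> currents" for x a
    using that dot_closed(2)[of a x] current_dot[of "x \<odot> a" "bar a"] dot_cancel(2)[of a x] current_bar[of a]
    by (metis DiffD1 DiffD2 DiffI)
  show "x \<odot> a \<in> nobles" by (rule 1[OF assms])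
  have "bar (bar x \<odot> bar a) \<in> nobles"
    using 1[OF noble_bar[OF assms(1)] current_bar[OF assms(2)]] by (rule noble_bar)
  then show "a \<odot> x \<in> nobles"
    using bar_dot_current(1)[of "bar a" "bar x"] assms by (simp add: current_bar)
qed

lemma noble_transitive_left:
  assumes "x \<in> nobles" "y \<in> nobles"
  shows "\<exists>a\<in>currents. y = a \<odot> x"
proof -
  obtain a where a: "a \<in> currents" "bar y = bar x \<odot> a"
    using noble_transitive[of "bar x" "bar y"] noble_bar assms by blast
  have "y = bar (bar y)" using assms by simp
  also have "\<dots> = bar a \<odot> x"
    using bar_dot_current(1)[of a "bar x"] a assms by simp
  finally show ?thesis using a current_bar by blast
qed

lemma square_const:
  assumes "x \<in> nobles" "y \<in> nobles"
  shows "{x} \<star> {bar x} = {y} \<star> {bar y}"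
  using noble_transitive[OF assms] square_dot[of _ x] assms by auto

text \<open>
  All products \<open>y (bar y)\<close> with \<open>y\<close> noble agree.  If one of them contains a noble \<open>z\<close>, then \<open>z\<close> lies in the adjoint
  subrule, and the product \<open>z (bar z)\<close>, formed inside that subrule, yields all its generators once more.
\<close>

lemma adjoint_stable:
  assumes x: "x \<in> nobles" and o: "z \<in> {x} \<star> {bar x}" "z \<in> nobles"
  shows "adjoint_subrule (restr (adjoint_subrule L)) = adjoint_subrule L"
proof
  let ?A = "adjoint_subrule L"
  have A: "subrule L ?A" by (rule subrule_adjoint)
  interpret A: fusion_struct "restr ?A" by unfold_locales (rule subrule_fusion_rule[OF A])
  let ?T = "adjoint_subrule (restr ?A)"
  show TA: "?T \<subseteq> ?A" using A.subrule_subset[OF A.subrule_adjoint] by simp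
  have T: "subrule L ?T"
    using A.subrule_adjoint subrule_restr_iff[OF A TA] by simp
  have zA: "z \<in> ?A"
    using adjoint_contains[of x] x o by auto
  have "set_prod (restr ?A) {z} {fr_bar (restr ?A) z} = {z} \<star> {bar z}"
    using zA by (simp add: set_prod_def subrule_bar_eq[OF A] subrule_supp[OF A] subrule_bar[OF A])
  with A.adjoint_contains[of z] zA have sq: "{z} \<star> {bar z} \<subseteq> ?T" by simp
  show "?A \<subseteq> ?T"
  proof (rule adjoint_least[OF T])
    fix y assume y: "y \<in> carrier L"
    show "{y} \<star> {bar y} \<subseteq> ?T"
    proof (cases "y \<in> currents")
      case True
      then show ?thesis using T by (simp add: current_bar_right subrule_def)
    next
      case False
      with y square_const[of y z] sq o(2) show ?thesis by simp
    qed
  qed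
qed

lemma square_subset_currents:
  assumes x: "x \<in> nobles"
  shows "{x} \<star> {bar x} \<subseteq> currents"
proof
  fix z assume z: "z \<in> {x} \<star> {bar x}"
  show "z \<in> currents"
  proof (rule ccontr)
    assume "z \<notin> currents"
    then have o: "z \<in> nobles" using z by (simp add: in_sprod)
    have series: "adjoint_series L (Suc n) = restr (adjoint_subrule L)" for n
      by (induction n) (use adjoint_stable[OF x z o] in simp_all)
    obtain n where n: "carrier (adjoint_series L n) = {\<epsilon>}"
      using nilpotent by (auto simp: nilpotent_def)
    have "z \<in> carrier (adjoint_series L n)"
      using adjoint_contains[of x] x z o by (cases n) (auto simp: series simp del: adjoint_series.simps(2))
    with n o show False by auto
  qed
qed

definition kern where "kern = {a \<in> currents. \<forall>x\<in>nobles. a \<odot> x = x}"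

text \<open>
  Rotating the multiplicity of \<open>a\<close> in \<open>x (bar x)\<close> turns it into that of \<open>x\<close> in \<open>(bar a) x\<close>, which is 1 or 0
  according as \<open>a\<close> fixes \<open>x\<close> or not.
\<close>

lemma square_eq_kern:
  assumes x: "x \<in> nobles"
  shows "{x} \<star> {bar x} = kern"
proof -
  have stab: "a \<in> {y} \<star> {bar y} \<longleftrightarrow> a \<odot> y = y" if "a \<in> currents" "y \<in> nobles" for a y
  proof -
    have "fusion L y (bar y) a = fusion L (bar a) y y"
      using fusion_rotate'(2)[of y "bar y" a] that by simp
    also have "\<dots> = (if y = bar a \<odot> y then 1 else 0)"
      using that by (intro fusion_current) (auto simp: current_bar)
    also have "y = bar a \<odot> y \<longleftrightarrow> a \<odot> y = y"
      using that dot_cancel(1)[of a y] dot_cancel(1)[of "bar a" y] current_bar[of a] by auto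
    finally show ?thesis using that by (simp add: in_sprod)
  qed
  show ?thesis
  proof (rule Set.set_eqI)
    fix a
    show "a \<in> {x} \<star> {bar x} \<longleftrightarrow> a \<in> kern"
      using stab square_const[OF x] square_subset_currents[OF x] x
      unfolding kern_def by blast
  qed
qed

lemma square_eq_kern':
  assumes "x \<in> nobles"
  shows "{bar x} \<star> {x} = kern"
  using square_eq_kern[OF noble_bar[OF assms]] assms by simp

lemma kern_subset: "kern \<subseteq> currents"
  by (auto simp: kern_def)

lemma kern_carrier: "kern \<subseteq> carrier L"
  using kern_subset by auto

lemma one_kern: "\<epsilon> \<in> kern"
  by (simp add: kern_def)

lemma finite_kern: "finite kern"
proof -
  obtain x where "x \<in> nobles" using nobles_nonempty by blast
  then show ?thesis
    using square_eq_kern[of x] finite_supp[of x "bar x"] by (simp add: supp_eq)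
qed

lemma kern_nontrivial: "kern \<noteq> {\<epsilon>}"
  using nobles_nonempty square_eq_kern currentI by blast

lemma kern_noble: "x \<in> nobles \<Longrightarrow> kern \<star> {x} = {x}"
proof
  assume x: "x \<in> nobles"
  show "kern \<star> {x} \<subseteq> {x}"
  proof
    fix z assume "z \<in> kern \<star> {x}"
    then obtain k where "k \<in> kern" "z \<in> {k} \<star> {x}"
      by (auto elim: sprodE)
    then show "z \<in> {x}" using x by (auto simp: kern_def current_dot_left)
  qed
  show "{x} \<subseteq> kern \<star> {x}"
    using sprod_mono[of "{\<epsilon>}" kern "{x}" "{x}"] one_kern x by auto
qed

text \<open>
  For a simple current \<open>x\<close> and a noble \<open>y\<close>, also \<open>xy\<close> is noble, and its product with its dual is
  \<open>x (y (bar y)) (bar x)\<close>: the conjugate of the stabiliser by \<open>x\<close> is the stabiliser again.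
\<close>

lemma kern_normal:
  assumes x: "x \<in> carrier L"
  shows "{x} \<star> kern = kern \<star> {x}"
proof (cases "x \<in> currents")
  case True
  obtain y where y: "y \<in> nobles" using nobles_nonempty by blast
  have "{x \<odot> y} \<star> {bar y \<odot> bar x} = ({x} \<star> {y}) \<star> ({bar y} \<star> {bar x})"
    using True y by (simp add: current_dot_left current_dot_right current_bar)
  also have "\<dots> = ({x} \<star> ({y} \<star> {bar y})) \<star> {bar x}"
    using x y by (simp add: sprod_assoc sprod_closed)
  finally have "kern = ({x} \<star> kern) \<star> {bar x}"
    using square_eq_kern[OF noble_dot(2)[OF y True]] square_eq_kern[OF y] True y
    by (simp add: bar_dot_current)
  then show ?thesis
    using current_cancel(4)[OF True sprod_closed, of "{x}" kern] by simp
next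
  case False
  then have "x \<in> nobles" using x by simp
  then show ?thesis
    using sprod_assoc[of "{x}" "{bar x}" "{x}"] square_eq_kern[of x] square_eq_kern'[of x] by simp
qed

lemma kern_idem: "kern \<star> kern = kern"
proof -
  obtain x where x: "x \<in> nobles" using nobles_nonempty by blast
  have "kern \<star> kern = (kern \<star> {x}) \<star> {bar x}"
    using sprod_assoc[of kern "{x}" "{bar x}"] square_eq_kern[OF x] x kern_carrier by simp
  then show ?thesis
    using kern_noble[OF x] square_eq_kern[OF x] by simp
qed

lemma kern_bar:
  assumes "k \<in> kern"
  shows "bar k \<in> kern"
proof -
  have k: "k \<in> currents" using assms kern_subset by auto
  have "bar k \<odot> x = x" if "x \<in> nobles" for x
    using dot_cancel(1)[of k x] k that assms by (simp add: kern_def)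
  then show ?thesis using current_bar[OF k] by (simp add: kern_def)
qed

lemma kern_absorb:
  assumes "k \<in> kern"
  shows "kern \<star> {k} = kern"
proof
  have k: "k \<in> currents" using assms kern_subset by auto
  have *: "kern \<star> {k} \<subseteq> kern" if "k \<in> kern" for k
    using sprod_mono[of kern kern "{k}" kern] kern_idem that by simp
  show "kern \<star> {k} \<subseteq> kern" by (rule *[OF assms])
  have "kern = (kern \<star> {bar k}) \<star> {k}"
    using current_cancel(4)[OF k kern_carrier] by simp
  also have "\<dots> \<subseteq> kern \<star> {k}"
    by (intro sprod_mono *[OF kern_bar[OF assms]] order_refl)
  finally show "kern \<subseteq> kern \<star> {k}" .
qed


subsection \<open>The quotient group\<close>

definition cls where "cls x = kern \<star> {x}"

lemma cls_mult:
  assumes "x \<in> carrier L" "y \<in> carrier L"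
  shows "cls x \<star> cls y = kern \<star> ({x} \<star> {y})"
proof -
  have "cls x \<star> cls y = kern \<star> (({x} \<star> kern) \<star> {y})"
    using assms kern_carrier by (simp add: cls_def sprod_assoc sprod_closed)
  also have "\<dots> = (kern \<star> kern) \<star> ({x} \<star> {y})"
    using assms kern_carrier unfolding kern_normal[OF assms(1)] by (simp add: sprod_assoc sprod_closed)
  finally show ?thesis by (simp add: kern_idem)
qed

lemma cls_mem: "x \<in> carrier L \<Longrightarrow> x \<in> cls x"
  unfolding cls_def using sprod_mono[of "{\<epsilon>}" kern "{x}" "{x}"] one_kern by auto

lemma cls_noble: "x \<in> nobles \<Longrightarrow> cls x = {x}"
  by (simp add: cls_def kern_noble)

lemma cls_kern: "k \<in> kern \<Longrightarrow> cls k = kern"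
  by (simp add: cls_def kern_absorb)

lemma cls_subset: "cls x \<subseteq> carrier L"
  by (simp add: cls_def sprod_closed)

lemma cls_current: "a \<in> currents \<Longrightarrow> cls a \<subseteq> currents"
proof
  fix z assume a: "a \<in> currents" and "z \<in> cls a"
  then obtain k where "k \<in> kern" "z \<in> {k} \<star> {a}"
    unfolding cls_def by (auto elim: sprodE)
  then show "z \<in> currents" using a kern_subset by (auto simp: current_dot_left)
qed

lemma cls_kern_dot:
  assumes "k \<in> kern" "x \<in> carrier L"
  shows "cls (k \<odot> x) = cls x"
proof -
  have k: "k \<in> currents" using assms kern_subset by auto
  have "cls (k \<odot> x) = kern \<star> ({k} \<star> {x})"
    using k assms by (simp add: cls_def current_dot_left)
  also have "\<dots> = (kern \<star> {k}) \<star> {x}"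
    using k assms kern_carrier by (simp add: sprod_assoc)
  finally show ?thesis by (simp add: kern_absorb assms cls_def)
qed

lemma cls_eq:
  assumes "x \<in> carrier L" "y \<in> cls x"
  shows "cls y = cls x"
proof -
  obtain k where k: "k \<in> kern" "y \<in> {k} \<star> {x}"
    using assms(2) unfolding cls_def by (auto elim: sprodE)
  then have "y = k \<odot> x"
    using current_dot_left[of k x] kern_subset assms(1) by auto
  then show ?thesis using cls_kern_dot k assms by simp
qed

text \<open>
  If \<open>x\<close> and \<open>y\<close> are noble, then \<open>y = (bar x) a\<close> for a simple current \<open>a\<close>, so that \<open>xy = x (bar x) a\<close>
  is the single class of \<open>a\<close>.
\<close>

lemma cls_prod:
  assumes "x \<in> carrier L" "y \<in> carrier L" "z \<in> {x} \<star> {y}"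
  shows "cls x \<star> cls y = cls z"
proof (cases "x \<in> currents \<or> y \<in> currents")
  case True
  then have "{x} \<star> {y} = {z}"
    using assms current_dot_left[of x y] current_dot_right[of y x] by auto
  then show ?thesis
    unfolding cls_mult[OF assms(1,2)] by (simp add: cls_def)
next
  case False
  then obtain a where a: "a \<in> currents" "y = bar x \<odot> a"
    using noble_transitive[OF noble_bar, of x y] assms by auto
  have "{x} \<star> {y} = {x} \<star> ({bar x} \<star> {a})"
    using a assms by (simp add: current_dot_right)
  also have "\<dots> = cls a"
    using False assms a sprod_assoc[of "{x}" "{bar x}" "{a}"] by (simp add: square_eq_kern cls_def)
  finally have xy: "{x} \<star> {y} = cls a" .
  have "kern \<star> cls a = cls a"
    using a kern_carrier sprod_assoc[of kern kern "{a}"] by (simp add: cls_def kern_idem)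
  then show ?thesis
    using cls_mult[OF assms(1,2)] cls_eq[of a z] assms(3) a unfolding xy by simp
qed

text \<open>
  The quotient group is built on representatives instead of classes in order to stay inside the type of \<open>L\<close>.
  The class of a noble is a singleton, so that nobles represent themselves.
\<close>

definition rep where "rep x = (SOME y. y \<in> cls x)"

lemma rep_mem: "x \<in> carrier L \<Longrightarrow> rep x \<in> cls x"
  unfolding rep_def using cls_mem by (rule someI)

lemma rep_closed [simp]: "x \<in> carrier L \<Longrightarrow> rep x \<in> carrier L"
  using rep_mem cls_subset by blast

lemma cls_rep: "x \<in> carrier L \<Longrightarrow> cls (rep x) = cls x"
  using cls_eq rep_mem by blast

lemma rep_eq_iff: "x \<in> carrier L \<Longrightarrow> y \<in> carrier L \<Longrightarrow> rep x = rep y \<longleftrightarrow> cls x = cls y"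
  by (metis cls_rep rep_def)

lemma rep_noble: "x \<in> nobles \<Longrightarrow> rep x = x"
  using rep_mem[of x] cls_noble[of x] by auto

lemma rep_current: "a \<in> currents \<Longrightarrow> rep a \<in> currents"
  using rep_mem[of a] cls_current[of a] by auto

text \<open>By \<open>cls_prod\<close> the elements of a product all lie in one class, so the choice among them has no effect.\<close>

definition quot where
  "quot = \<lparr>carrier = rep ` carrier L, mult = (\<lambda>g h. rep (SOME z. z \<in> {g} \<star> {h})), one = rep \<epsilon>\<rparr>"

lemma quot_mult:
  assumes "x \<in> carrier L" "y \<in> carrier L" "z \<in> {x} \<star> {y}"
  shows "rep x \<otimes>\<^bsub>quot\<^esub> rep y = rep z"
proof -
  define w where "w = (SOME w. w \<in> {rep x} \<star> {rep y})"
  have w: "w \<in> {rep x} \<star> {rep y}"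
    unfolding w_def by (rule someI_ex) (use sprod_nonempty[of "rep x" "rep y"] assms in auto)
  have "cls w = cls (rep x) \<star> cls (rep y)"
    using cls_prod[OF _ _ w] assms by simp
  also have "\<dots> = cls z"
    using cls_prod[OF assms] assms by (simp add: cls_rep)
  finally have "rep w = rep z"
    by (simp add: rep_def)
  then show ?thesis by (simp add: quot_def w_def)
qed

lemma quot_group: "group quot"
proof (rule groupI)
  show "\<one>\<^bsub>quot\<^esub> \<in> carrier quot" by (simp add: quot_def)
  fix g assume "g \<in> carrier quot"
  then obtain x where x: "x \<in> carrier L" "g = rep x" by (auto simp: quot_def)
  have "rep \<epsilon> \<otimes>\<^bsub>quot\<^esub> rep x = rep x"
    by (rule quot_mult) (use x in simp_all)
  then show "\<one>\<^bsub>quot\<^esub> \<otimes>\<^bsub>quot\<^esub> g = g" using x by (simp add: quot_def)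
  have "rep (bar x) \<otimes>\<^bsub>quot\<^esub> rep x = rep \<epsilon>"
    by (rule quot_mult) (use x one_in_sprod_bar in simp_all)
  then show "\<exists>h\<in>carrier quot. h \<otimes>\<^bsub>quot\<^esub> g = \<one>\<^bsub>quot\<^esub>"
    using x by (auto simp: quot_def)
  fix h assume "h \<in> carrier quot"
  then obtain y where y: "y \<in> carrier L" "h = rep y" by (auto simp: quot_def)
  obtain u where u: "u \<in> {x} \<star> {y}" using sprod_nonempty[OF x(1) y(1)] by blast
  have uL: "u \<in> carrier L" using u by (simp add: in_sprod)
  have gh: "g \<otimes>\<^bsub>quot\<^esub> h = rep u" using quot_mult[OF x(1) y(1) u] x y by simp
  then show "g \<otimes>\<^bsub>quot\<^esub> h \<in> carrier quot" using uL by (simp add: quot_def)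
  fix k assume "k \<in> carrier quot"
  then obtain z where z: "z \<in> carrier L" "k = rep z" by (auto simp: quot_def)
  obtain v where v: "v \<in> {u} \<star> {z}" using sprod_nonempty[OF uL z(1)] by blast
  have "v \<in> ({x} \<star> {y}) \<star> {z}"
    using v u sprod_mono[of "{u}" "{x} \<star> {y}" "{z}" "{z}"] by auto
  then have "v \<in> {x} \<star> ({y} \<star> {z})"
    using sprod_assoc[of "{x}" "{y}" "{z}"] x y z by simp
  then obtain w where w: "w \<in> {y} \<star> {z}" "v \<in> {x} \<star> {w}"
    by (auto elim: sprodE)
  then have "w \<in> carrier L" by (simp add: in_sprod)
  then show "g \<otimes>\<^bsub>quot\<^esub> h \<otimes>\<^bsub>quot\<^esub> k = g \<otimes>\<^bsub>quot\<^esub> (h \<otimes>\<^bsub>quot\<^esub> k)"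
    using gh quot_mult[OF uL z(1) v] quot_mult[OF y(1) z(1) w(1)] quot_mult[OF x(1) _ w(2)] x y z
    by simp
qed

lemma quot_carrier: "carrier quot = rep ` currents \<union> nobles"
proof -
  have "rep ` carrier L = rep ` currents \<union> rep ` nobles"
    using currents_subset by (simp add: image_Un[symmetric] Un_absorb1)
  also have "rep ` nobles = nobles"
    by (simp add: rep_noble)
  finally show ?thesis by (simp add: quot_def)
qed

lemma rep_currents_subset: "rep ` currents \<subseteq> currents"
  using rep_current by auto

lemma quot_noble_left:
  assumes "a \<in> currents" "x \<in> nobles"
  shows "rep a \<otimes>\<^bsub>quot\<^esub> x = a \<odot> x"
  using quot_mult[of a x "a \<odot> x"] assms noble_dot(2)[of x a]
  by (simp add: rep_noble current_dot_left)

lemma quot_noble_right: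
  assumes "a \<in> currents" "x \<in> nobles"
  shows "x \<otimes>\<^bsub>quot\<^esub> rep a = x \<odot> a"
  using quot_mult[of x a "x \<odot> a"] assms noble_dot(1)[of x a]
  by (simp add: rep_noble current_dot_right)

lemma rep_hom: "rep \<in> hom current_group quot"
proof (rule homI)
  fix a b assume "a \<in> carrier current_group" "b \<in> carrier current_group"
  then show "rep (a \<otimes>\<^bsub>current_group\<^esub> b) = rep a \<otimes>\<^bsub>quot\<^esub> rep b"
    using quot_mult[of a b "a \<odot> b"] by (simp add: current_group_def current_dot_left)
qed (simp add: current_group_def quot_def)

lemma rep_kernel: "kernel current_group quot rep = kern"
proof -
  have "a \<in> kern \<longleftrightarrow> rep a = rep \<epsilon>" if "a \<in> currents" for a
    using that cls_kern[OF one_kern] cls_kern[of a] cls_mem[of a] by (auto simp: rep_eq_iff)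
  then show ?thesis
    using kern_subset by (auto simp: kernel_def current_group_def quot_def)
qed

lemma rep_rcosets: "card (rcosets\<^bsub>quot\<^esub> (rep ` currents)) = 2"
proof -
  interpret Q: group quot by (rule quot_group)
  interpret group_hom current_group quot rep
    using current_group quot_group rep_hom by (simp add: group_hom_def group_hom_axioms_def)
  let ?H = "rep ` currents"
  have H: "subgroup ?H quot"
    using img_is_subgroup by (simp add: current_group_def)
  have "?H #>\<^bsub>quot\<^esub> g = ?H" if "g \<in> ?H" for g
    using Q.coset_join2[OF _ H] that subgroup.subset[OF H] by blast
  moreover have "?H #>\<^bsub>quot\<^esub> g = nobles" if g: "g \<in> nobles" for g
  proof -
    have "?H #>\<^bsub>quot\<^esub> g = (\<lambda>a. a \<odot> g) ` currents"
      using g by (auto simp: r_coset_def quot_noble_left)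
    also have "\<dots> = nobles"
      using noble_dot(2)[OF g] noble_transitive_left[OF g] by blast
    finally show ?thesis .
  qed
  moreover obtain x where "x \<in> nobles" using nobles_nonempty by blast
  moreover have "rep \<epsilon> \<in> ?H" by simp
  ultimately have "rcosets\<^bsub>quot\<^esub> ?H = {?H, nobles}"
    unfolding RCOSETS_def quot_carrier by blast
  moreover have "?H \<noteq> nobles"
    using \<open>rep \<epsilon> \<in> ?H\<close> rep_currents_subset by blast
  ultimately show ?thesis by simp
qed

lemma feudal_hom_rep: "feudal_hom (current_group, quot, rep)"
  using current_group quot_group rep_hom rep_rcosets kern_nontrivial finite_kern
  by (simp add: feudal_hom_def rep_kernel) (simp add: current_group_def)

text \<open>
  The support of \<open>xy\<close> is a class of simple currents.  That its elements have multiplicity 1 follows by rotation: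
  the multiplicity of \<open>z\<close> in \<open>xy\<close> is that of \<open>bar x\<close> in the product of \<open>y\<close> with the simple current \<open>bar z\<close>.
\<close>

lemma fusion_noble_noble:
  assumes x: "x \<in> nobles" and y: "y \<in> nobles" and z: "z \<in> carrier L"
  shows "fusion L x y z = (if z \<in> currents \<and> rep z = x \<otimes>\<^bsub>quot\<^esub> y then 1 else 0)"
proof -
  obtain w where w: "w \<in> {x} \<star> {y}" using sprod_nonempty[of x y] x y by blast
  have xy: "{x} \<star> {y} = cls w"
    using cls_prod[OF _ _ w] x y by (simp add: cls_noble)
  have wL: "w \<in> carrier L" using w by (simp add: in_sprod)
  have prod: "x \<otimes>\<^bsub>quot\<^esub> y = rep w"
    using quot_mult[OF _ _ w] x y by (simp add: rep_noble)
  have "{x} \<star> {y} \<subseteq> currents"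
  proof -
    obtain a where a: "a \<in> currents" "y = bar x \<odot> a"
      using noble_transitive[OF noble_bar, of x y] x y by auto
    have "{x} \<star> {y} = ({x} \<star> {bar x}) \<star> {a}"
      using a x by (simp add: current_dot_right sprod_assoc)
    then show ?thesis
      using cls_current[OF a(1)] x by (simp add: square_eq_kern cls_def)
  qed
  moreover have "z \<in> cls w \<longleftrightarrow> rep z = rep w"
    using cls_mem[OF z] cls_eq[OF wL, of z] by (auto simp: rep_eq_iff z wL)
  ultimately have pos: "fusion L x y z > 0 \<longleftrightarrow> z \<in> currents \<and> rep z = x \<otimes>\<^bsub>quot\<^esub> y"
    using in_sprod[of z "{x}" "{y}"] xy z prod by auto
  moreover have "fusion L x y z \<le> 1" if "z \<in> currents"
  proof -
    have "fusion L x y z = fusion L y (bar z) (bar x)"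
      using x y z by (intro fusion_rotate') auto
    also have "\<dots> \<le> 1"
      using fusion_current(2)[of "bar z" y "bar x"] current_bar[OF that] x y by simp
    finally show ?thesis .
  qed
  ultimately show ?thesis by (cases "fusion L x y z") auto
qed

lemma mm_iso_feudal_of_hom: "mm_iso L (feudal_of_hom (current_group, quot, rep))"
proof -
  define f where "f x = (if x \<in> currents then Inl x else Inr x)" for x
  let ?M = "feudal_of_hom (current_group, quot, rep)"
  have carr: "carrier ?M = Inl ` currents \<union> Inr ` nobles"
  proof -
    have "carrier quot - rep ` currents = nobles"
      using rep_currents_subset unfolding quot_carrier by blast
    then show ?thesis
      by (simp add: feudal_of_hom_def current_group_def)
  qed
  have "inj_on f (carrier L)" by (auto simp: inj_on_def f_def split: if_splits)
  moreover have "f ` carrier L = carrier ?M"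
    using currents_subset unfolding carr by (auto simp: f_def image_iff)
  moreover have "fusion ?M (f x) (f y) (f z) = fusion L x y z"
    if C: "x \<in> carrier L" "y \<in> carrier L" "z \<in> carrier L" for x y z
  proof -
    consider "x \<in> currents" "y \<in> currents" | "x \<in> currents" "y \<in> nobles"
      | "x \<in> nobles" "y \<in> currents" | "x \<in> nobles" "y \<in> nobles"
      using C by blast
    then show ?thesis
    proof cases
      case 1
      then show ?thesis using fusion_current(1)[of x y z] current_dot[of x y] C
        by (auto simp: f_def feudal_of_hom_def current_group_def indicator_def)
    next
      case 2
      then show ?thesis using fusion_current(1)[of x y z] noble_dot(2)[of y x] C
        by (auto simp: f_def feudal_of_hom_def indicator_def quot_noble_left)
    next
      case 3
      then show ?thesis using fusion_current(2)[of y x z] noble_dot(1)[of x y] C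
        by (auto simp: f_def feudal_of_hom_def indicator_def quot_noble_right)
    next
      case 4
      then show ?thesis using fusion_noble_noble[of x y z] C
        by (auto simp: f_def feudal_of_hom_def indicator_def current_group_def image_iff)
    qed
  qed
  ultimately show ?thesis
    unfolding mm_iso_def bij_betw_def by blast
qed

end

lemma properly_feudal_imp_feudal_of_hom:
  fixes L :: "'a multimagma"
  assumes "properly_feudal L"
  shows "\<exists>u :: ('a, 'a) hom_data. feudal_hom u \<and> mm_iso L (feudal_of_hom u)"
proof -
  interpret feudal_struct L
    using assms by unfold_locales (simp_all add: properly_feudal_def)
  show ?thesis using feudal_hom_rep mm_iso_feudal_of_hom by blast
qed


section \<open>Isomorphic homomorphisms and isomorphic fusion rules\<close>

lemma hom_iso_imp_mm_iso:
  assumes "feudal_hom (S, G, u)" "feudal_hom (S', G', u')" "hom_iso (S, G, u) (S', G', u')"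
  shows "mm_iso (feudal_of_hom (S, G, u)) (feudal_of_hom (S', G', u'))"
proof -
  interpret A: feudal_hom_data S G u by unfold_locales (rule assms(1))
  interpret B: feudal_hom_data S' G' u' by unfold_locales (rule assms(2))
  obtain h0 h1 where h0: "h0 \<in> iso S S'" and h1: "h1 \<in> iso G G'"
    and u: "\<And>s. s \<in> carrier S \<Longrightarrow> h1 (u s) = u' (h0 s)"
    using assms(3) by (auto simp: hom_iso_def)
  have b0: "bij_betw h0 (carrier S) (carrier S')" and b1: "bij_betw h1 (carrier G) (carrier G')"
    and m0: "\<And>s t. s \<in> carrier S \<Longrightarrow> t \<in> carrier S \<Longrightarrow> h0 (s \<otimes>\<^bsub>S\<^esub> t) = h0 s \<otimes>\<^bsub>S'\<^esub> h0 t"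
    and m1: "\<And>g h. g \<in> carrier G \<Longrightarrow> h \<in> carrier G \<Longrightarrow> h1 (g \<otimes>\<^bsub>G\<^esub> h) = h1 g \<otimes>\<^bsub>G'\<^esub> h1 h"
    using h0 h1 by (auto simp: iso_def hom_def)
  have c0: "\<And>s. s \<in> carrier S \<Longrightarrow> h0 s \<in> carrier S'"
    using b0 by (auto simp: bij_betw_def)
  have i0: "h0 s = h0 t \<longleftrightarrow> s = t" if "s \<in> carrier S" "t \<in> carrier S" for s t
    using b0 that by (auto simp: bij_betw_def inj_on_def)
  have i1: "h1 g = h1 h \<longleftrightarrow> g = h" if "g \<in> carrier G" "h \<in> carrier G" for g h
    using b1 that by (auto simp: bij_betw_def inj_on_def)
  have H: "h1 ` A.H = B.H"
  proof -
    have "h1 ` A.H = u' ` h0 ` carrier S"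
      unfolding image_image by (rule image_cong) (simp_all add: u)
    then show ?thesis using b0 by (simp add: bij_betw_def)
  qed
  have R: "h1 ` A.R = B.R"
    using b1 subgroup.subset[OF A.H] unfolding A.R_def B.R_def H[symmetric]
    by (simp add: bij_betw_def inj_on_image_set_diff[of h1 "carrier G"])
  have cR: "\<And>g. g \<in> A.R \<Longrightarrow> h1 g \<in> B.R"
    using R by auto
  let ?f = "map_sum h0 h1"
  have "inj_on ?f (carrier A.M)"
    using i0 i1 by (auto simp: inj_on_def A.carrier_M)
  moreover have "?f ` carrier A.M = carrier B.M"
  proof -
    have "?f ` carrier A.M = Inl ` h0 ` carrier S \<union> Inr ` h1 ` A.R"
      by (simp add: A.carrier_M image_Un image_image)
    then show ?thesis using b0 R by (simp add: bij_betw_def B.carrier_M)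
  qed
  moreover have "fusion B.M (?f x) (?f y) (?f z) = fusion A.M x y z"
    if x: "x \<in> carrier A.M" and y: "y \<in> carrier A.M" and z: "z \<in> carrier A.M" for x y z
  proof -
    have fib: "h0 s \<in> B.fib (h1 g) \<longleftrightarrow> s \<in> A.fib g"
      if "s \<in> carrier S" "g \<in> carrier G" for s g
      using that by (simp add: A.fib_def B.fib_def c0 i1 flip: u)
    show ?thesis
      using x
    proof (cases rule: A.M_cases)
      case x: (1 s)
      show ?thesis using y
      proof (cases rule: A.M_cases)
        case y: (1 t)
        show ?thesis using z
          by (cases rule: A.M_cases) (use x y in \<open>simp_all add: indicator_def i0 flip: m0\<close>)
      next
        case y: (2 h)
        show ?thesis using z
          by (cases rule: A.M_cases) (use x y in \<open>simp_all add: indicator_def i1 flip: u m1\<close>)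
      qed
    next
      case x: (2 g)
      show ?thesis using y
      proof (cases rule: A.M_cases)
        case y: (1 t)
        show ?thesis using z
          by (cases rule: A.M_cases) (use x y in \<open>simp_all add: indicator_def i1 flip: u m1\<close>)
      next
        case y: (2 h)
        show ?thesis using z
          by (cases rule: A.M_cases) (use x y in \<open>auto simp: indicator_def inj_image_mem_iff fib simp flip: m1\<close>)
      qed
    qed
  qed
  ultimately show ?thesis
    unfolding mm_iso_def bij_betw_def by blast
qed

text \<open>
  An isomorphism preserves simple currents, hence splits into maps \<open>S \<rightarrow> S'\<close> and \<open>p: R \<rightarrow> R'\<close>.  On the
  image of \<open>u\<close> the group isomorphism is forced to be \<open>u s \<mapsto> u' (h0 s)\<close>; this is a well-defined
  injection because \<open>u s\<close> is determined by the translate \<open>u s \<cdot> g\<close> of any fixed \<open>g \<in> R\<close>.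
\<close>

lemma mm_iso_imp_hom_iso:
  assumes "feudal_hom (S, G, u)" "feudal_hom (S', G', u')"
    "mm_iso (feudal_of_hom (S, G, u)) (feudal_of_hom (S', G', u'))"
  shows "hom_iso (S, G, u) (S', G', u')"
proof -
  interpret A: feudal_hom_data S G u by unfold_locales (rule assms(1))
  interpret B: feudal_hom_data S' G' u' by unfold_locales (rule assms(2))
  obtain f where f: "fusion_map f A.M B.M" using assms(3) mm_iso_iff by blast
  interpret f: fusion_iso A.M B.M f by unfold_locales (rule f)
  have fS: "f ` Inl ` carrier S = Inl ` carrier S'"
    using f.image_simple_currents by (simp add: A.simple_currents_M B.simple_currents_M)
  have fR: "f ` Inr ` A.R = Inr ` B.R"
  proof -
    have "Inr ` A.R = carrier A.M - Inl ` carrier S" "Inr ` B.R = carrier B.M - Inl ` carrier S'"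
      by (auto simp: A.carrier_M B.carrier_M)
    then show ?thesis
      using inj_on_image_set_diff[OF f.inj, of "carrier A.M" "Inl ` carrier S"] fS
      by (simp add: f.surj A.carrier_M)
  qed
  define h0 where "h0 s = projl (f (Inl s))" for s
  define p where "p g = projr (f (Inr g))" for g
  have f0: "f (Inl s) = Inl (h0 s)" "h0 s \<in> carrier S'" if "s \<in> carrier S" for s
  proof -
    have "f (Inl s) \<in> Inl ` carrier S'" using fS that by blast
    then show "f (Inl s) = Inl (h0 s)" "h0 s \<in> carrier S'" by (auto simp: h0_def)
  qed
  have f1: "f (Inr g) = Inr (p g)" "p g \<in> B.R" if "g \<in> A.R" for g
  proof -
    have "f (Inr g) \<in> Inr ` B.R" using fR that by blast
    then show "f (Inr g) = Inr (p g)" "p g \<in> B.R" by (auto simp: p_def)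
  qed
  have i0: "h0 s = h0 t \<longleftrightarrow> s = t" if "s \<in> carrier S" "t \<in> carrier S" for s t
    using f.map_eq_iff[of "Inl s" "Inl t"] that by (simp add: f0)
  have i1: "p g = p h \<longleftrightarrow> g = h" if "g \<in> A.R" "h \<in> A.R" for g h
    using f.map_eq_iff[of "Inr g" "Inr h"] that by (simp add: f1)
  have s0: "h0 ` carrier S = carrier S'"
  proof -
    have "Inl ` h0 ` carrier S = f ` Inl ` carrier S"
      unfolding image_image by (rule image_cong) (simp_all add: f0)
    then show ?thesis using fS by (simp add: inj_image_eq_iff)
  qed
  have s1: "p ` A.R = B.R"
  proof -
    have "Inr ` p ` A.R = f ` Inr ` A.R"
      unfolding image_image by (rule image_cong) (simp_all add: f1)
    then show ?thesis using fR by (simp add: inj_image_eq_iff)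
  qed
  have m0: "h0 (s \<otimes>\<^bsub>S\<^esub> t) = h0 s \<otimes>\<^bsub>S'\<^esub> h0 t" if "s \<in> carrier S" "t \<in> carrier S" for s t
    using f.fusion_image[of "Inl s" "Inl t" "Inl (s \<otimes>\<^bsub>S\<^esub> t)"] that
    by (simp add: f0 indicator_def of_bool_def split: if_splits)
  have mSR: "p (u s \<otimes>\<^bsub>G\<^esub> g) = u' (h0 s) \<otimes>\<^bsub>G'\<^esub> p g" if "s \<in> carrier S" "g \<in> A.R" for s g
    using f.fusion_image[of "Inl s" "Inr g" "Inr (u s \<otimes>\<^bsub>G\<^esub> g)"] that A.R_mult_H[OF that(2,1)]
    by (simp add: f0 f1 indicator_def of_bool_def split: if_splits)
  have mRS: "p (g \<otimes>\<^bsub>G\<^esub> u s) = p g \<otimes>\<^bsub>G'\<^esub> u' (h0 s)" if "s \<in> carrier S" "g \<in> A.R" for s g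
    using f.fusion_image[of "Inr g" "Inl s" "Inr (g \<otimes>\<^bsub>G\<^esub> u s)"] that A.R_mult_H[OF that(2,1)]
    by (simp add: f0 f1 indicator_def of_bool_def split: if_splits)
  have mRR: "u' (h0 t) = p g \<otimes>\<^bsub>G'\<^esub> p h"
    if "t \<in> carrier S" "g \<in> A.R" "h \<in> A.R" "u t = g \<otimes>\<^bsub>G\<^esub> h" for t g h
  proof -
    have "h0 t \<in> B.fib (p g \<otimes>\<^bsub>G'\<^esub> p h)"
      using f.fusion_image[of "Inr g" "Inr h" "Inl t"] that
      by (simp add: f0 f1 A.fib_def indicator_def of_bool_def inj_image_mem_iff split: if_splits)
    then show ?thesis by (simp add: B.fib_def)
  qed
  have u_iff: "u' (h0 s) = u' (h0 t) \<longleftrightarrow> u s = u t" if s: "s \<in> carrier S" and t: "t \<in> carrier S" for s t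
  proof -
    obtain g where g: "g \<in> A.R" using A.R_nonempty by blast
    have "u' (h0 s) = u' (h0 t) \<longleftrightarrow> u' (h0 s) \<otimes>\<^bsub>G'\<^esub> p g = u' (h0 t) \<otimes>\<^bsub>G'\<^esub> p g"
      using s t f0 f1[OF g] by simp
    also have "\<dots> \<longleftrightarrow> p (u s \<otimes>\<^bsub>G\<^esub> g) = p (u t \<otimes>\<^bsub>G\<^esub> g)"
      using s t g by (simp add: mSR)
    also have "\<dots> \<longleftrightarrow> u s \<otimes>\<^bsub>G\<^esub> g = u t \<otimes>\<^bsub>G\<^esub> g"
      using s t g by (intro i1 A.R_mult_H)
    also have "\<dots> \<longleftrightarrow> u s = u t"
      using s t g by simp
    finally show ?thesis .
  qed
  define h1 where "h1 y = (if y \<in> A.H then u' (h0 (SOME s. s \<in> carrier S \<and> u s = y)) else p y)" for y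
  have h1u: "h1 (u s) = u' (h0 s)" if s: "s \<in> carrier S" for s
  proof -
    define t where "t = (SOME t. t \<in> carrier S \<and> u t = u s)"
    have "t \<in> carrier S \<and> u t = u s"
      unfolding t_def by (rule someI[of _ s]) (simp add: s)
    then show ?thesis
      using u_iff[of t s] s by (simp add: h1_def t_def)
  qed
  have h1R: "h1 g = p g" if "g \<in> A.R" for g
    using that by (simp add: h1_def A.R_def)
  have G_cases: thesis
    if "y \<in> carrier G" "\<And>s. s \<in> carrier S \<Longrightarrow> y = u s \<Longrightarrow> thesis" "y \<in> A.R \<Longrightarrow> thesis" for y thesis
    using that by (auto simp: A.R_def)
  have iso0: "h0 \<in> iso S S'"
    using i0 s0 m0 f0 by (auto simp: iso_def hom_def bij_betw_def inj_on_def)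
  have im: "h1 ` A.H = B.H"
  proof -
    have "h1 ` A.H = u' ` h0 ` carrier S"
      unfolding image_image by (rule image_cong) (simp_all add: h1u)
    then show ?thesis by (simp add: s0)
  qed
  have imR: "h1 ` A.R = B.R"
    unfolding s1[symmetric] by (rule image_cong) (simp_all add: h1R)
  have G: "carrier G = A.H \<union> A.R" "carrier G' = B.H \<union> B.R"
    using subgroup.subset[OF A.H] subgroup.subset[OF B.H] by (auto simp: A.R_def B.R_def)
  have surj: "h1 ` carrier G = carrier G'"
    unfolding G image_Un im imR ..
  have inj: "inj_on h1 (carrier G)"
  proof -
    have "inj_on h1 A.H" by (auto simp: inj_on_def h1u u_iff)
    moreover have "inj_on h1 A.R" by (auto simp: inj_on_def h1R i1)
    moreover have "h1 ` (A.H - A.R) \<inter> h1 ` (A.R - A.H) = {}"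
    proof -
      have "h1 ` (A.H - A.R) \<inter> h1 ` (A.R - A.H) \<subseteq> B.H \<inter> B.R"
        unfolding im[symmetric] imR[symmetric] by blast
      then show ?thesis by (auto simp: B.R_def)
    qed
    ultimately show ?thesis unfolding G inj_on_Un by blast
  qed
  have mult: "h1 (y \<otimes>\<^bsub>G\<^esub> z) = h1 y \<otimes>\<^bsub>G'\<^esub> h1 z" if y: "y \<in> carrier G" and z: "z \<in> carrier G" for y z
    using y
  proof (rule G_cases)
    fix s assume s: "s \<in> carrier S" "y = u s"
    show ?thesis using z
    proof (rule G_cases)
      fix t assume t: "t \<in> carrier S" "z = u t"
      have "h1 (u (s \<otimes>\<^bsub>S\<^esub> t)) = u' (h0 s) \<otimes>\<^bsub>G'\<^esub> u' (h0 t)"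
        using s t by (subst h1u) (simp_all add: m0 f0)
      then show ?thesis using s t by (simp add: h1u)
    next
      assume "z \<in> A.R"
      then show ?thesis using s A.R_mult_H[of z s] by (simp add: h1R h1u mSR)
    qed
  next
    assume y: "y \<in> A.R"
    show ?thesis using z
    proof (rule G_cases)
      fix t assume "t \<in> carrier S" "z = u t"
      then show ?thesis using y A.R_mult_H[of y t] by (simp add: h1R h1u mRS)
    next
      assume z: "z \<in> A.R"
      obtain t where t: "t \<in> carrier S" "u t = y \<otimes>\<^bsub>G\<^esub> z"
        using A.R_mult_R[OF y z] by auto
      then show ?thesis using mRR[OF t(1) y z t(2)] h1u[OF t(1)] by (simp add: h1R y z)
    qed
  qed
  have iso1: "h1 \<in> iso G G'"
    using inj surj mult by (auto simp: iso_def hom_def bij_betw_def)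
  show ?thesis
    using iso0 iso1 h1u unfolding hom_iso_def by auto
qed

lemma hom_iso_iff_mm_iso:
  assumes "feudal_hom U" "feudal_hom V"
  shows "hom_iso U V \<longleftrightarrow> mm_iso (feudal_of_hom U) (feudal_of_hom V)"
proof -
  obtain S G u S' G' u' where [simp]: "U = (S, G, u)" "V = (S', G', u')"
    by (cases U, cases V) auto
  show ?thesis
    using hom_iso_imp_mm_iso[of S G u S' G' u'] mm_iso_imp_hom_iso[of S G u S' G' u'] assms by auto
qed

lemma properly_feudal_feudal_of_hom: "feudal_hom U \<Longrightarrow> properly_feudal (feudal_of_hom U)"
proof -
  assume U: "feudal_hom U"
  obtain S G u where eq: "U = (S, G, u)" by (cases U)
  interpret feudal_hom_data S G u by unfold_locales (use U eq in simp)
  show ?thesis using properly_feudal_M eq by simp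
qed


section \<open>The correspondence\<close>

lemma equiv_feudal_hom_iso: "equiv {u. feudal_hom u} feudal_hom_iso"
proof (rule equivI)
  show "feudal_hom_iso \<subseteq> {u. feudal_hom u} \<times> {u. feudal_hom u}"
    by (auto simp: feudal_hom_iso_def)
  show "refl_on {u. feudal_hom u} feudal_hom_iso"
    by (auto simp: refl_on_def feudal_hom_iso_def hom_iso_iff_mm_iso mm_iso_refl)
  show "sym feudal_hom_iso"
    by (auto simp: sym_def feudal_hom_iso_def hom_iso_iff_mm_iso mm_iso_sym)
  show "trans feudal_hom_iso"
    unfolding trans_def feudal_hom_iso_def
    by (auto simp: hom_iso_iff_mm_iso intro: mm_iso_trans)
qed

lemma mm_iso_copy:
  fixes M :: "'b multimagma" and j :: "'b \<Rightarrow> 'a"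
  assumes "inj j"
  shows "\<exists>L :: 'a multimagma. mm_iso L M"
proof -
  let ?L = "\<lparr>carrier = j ` carrier M, fusion = (\<lambda>x y z. fusion M (the_inv j x) (the_inv j y) (the_inv j z))\<rparr>"
  have "fusion_map j M ?L"
    using assms inj_on_subset[OF assms subset_UNIV] by (auto simp: fusion_map_def bij_betw_def the_inv_f_f)
  then show ?thesis using mm_iso_sym mm_iso_iff by blast
qed

lemma infinite_sum_inj:
  assumes "infinite (UNIV :: 'a set)"
  shows "\<exists>j :: 'a + 'a \<Rightarrow> 'a. inj j"
proof -
  have "(card_of (UNIV <+> UNIV :: ('a + 'a) set), card_of (UNIV :: 'a set)) \<in> ordIso"
    using card_of_Plus_infinite1[OF assms card_of_mono1[OF subset_refl]] .
  then show ?thesis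
    using card_of_ordLeq[of "UNIV :: ('a + 'a) set" "UNIV :: 'a set"] ordIso_imp_ordLeq by auto
qed

text \<open>The attached class does not depend on the representative, as isomorphic homomorphisms have isomorphic fusion rules.\<close>

lemma feudal_class_of_eq:
  assumes "feudal_hom U"
  shows "feudal_class_of (feudal_hom_iso `` {U}) = {L. mm_iso L (feudal_of_hom U)}"
proof
  show "feudal_class_of (feudal_hom_iso `` {U}) \<subseteq> {L. mm_iso L (feudal_of_hom U)}"
    using assms
    by (auto simp: feudal_class_of_def feudal_hom_iso_def hom_iso_iff_mm_iso;
        metis mm_iso_trans mm_iso_sym)
  have "U \<in> feudal_hom_iso `` {U}"
    using equiv_class_self[OF equiv_feudal_hom_iso, of U] assms by simp
  then show "{L. mm_iso L (feudal_of_hom U)} \<subseteq> feudal_class_of (feudal_hom_iso `` {U})"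
    by (auto simp: feudal_class_of_def)
qed

lemma iso_copies_eq_class:
  fixes L :: "'a multimagma"
  assumes "feudal_hom U" "mm_iso L (feudal_of_hom U)"
  shows "properly_feudal L" "{K. mm_iso K (feudal_of_hom U)} = properly_feudal_iso `` {L}"
proof -
  have pf: "properly_feudal K" if "mm_iso K (feudal_of_hom U)" for K :: "'a multimagma"
    using properly_feudal_iso_invariant[OF properly_feudal_feudal_of_hom[OF assms(1)] mm_iso_sym[OF that]] .
  show "properly_feudal L" by (rule pf[OF assms(2)])
  have "mm_iso K (feudal_of_hom U) \<longleftrightarrow> mm_iso L K" for K :: "'a multimagma"
    using assms(2) mm_iso_trans mm_iso_sym by metis
  then show "{K. mm_iso K (feudal_of_hom U)} = properly_feudal_iso `` {L}"
    using pf \<open>properly_feudal L\<close> by (auto simp: properly_feudal_iso_def)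
qed

theorem corollary2p7:
  assumes "infinite (UNIV :: 'a set)"
  shows "bij_betw (feudal_class_of :: ('a, 'a) hom_data set \<Rightarrow> 'a multimagma set)
           feudal_hom_classes properly_feudal_classes"
proof -
  let ?F = "feudal_class_of :: ('a, 'a) hom_data set \<Rightarrow> 'a multimagma set"
  have copy: "\<exists>L :: 'a multimagma. mm_iso L (feudal_of_hom U)" for U :: "('a, 'a) hom_data"
    using infinite_sum_inj[OF assms] mm_iso_copy by blast
  have "inj_on ?F feudal_hom_classes"
  proof (rule inj_onI)
    fix C D :: "('a, 'a) hom_data set"
    assume "C \<in> feudal_hom_classes" "D \<in> feudal_hom_classes" and eq: "?F C = ?F D"
    then obtain U V where U: "feudal_hom U" "C = feudal_hom_iso `` {U}"
      and V: "feudal_hom V" "D = feudal_hom_iso `` {V}"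
      by (auto simp: feudal_hom_classes_def quotient_def)
    obtain L :: "'a multimagma" where L: "mm_iso L (feudal_of_hom U)" using copy by blast
    then have "mm_iso L (feudal_of_hom V)"
      using eq U V by (auto simp: feudal_class_of_eq)
    with L have "mm_iso (feudal_of_hom U) (feudal_of_hom V)"
      using mm_iso_trans mm_iso_sym by blast
    then have "(U, V) \<in> feudal_hom_iso"
      using U V by (simp add: feudal_hom_iso_def hom_iso_iff_mm_iso)
    then show "C = D"
      using equiv_class_eq[OF equiv_feudal_hom_iso] U V by simp
  qed
  moreover have "?F ` feudal_hom_classes = properly_feudal_classes"
  proof
    show "?F ` feudal_hom_classes \<subseteq> properly_feudal_classes"
    proof
      fix X assume "X \<in> ?F ` feudal_hom_classes"
      then obtain U :: "('a, 'a) hom_data" where U: "feudal_hom U" "X = ?F (feudal_hom_iso `` {U})"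
        by (auto simp: feudal_hom_classes_def quotient_def)
      obtain L :: "'a multimagma" where "mm_iso L (feudal_of_hom U)" using copy by blast
      from iso_copies_eq_class[OF U(1) this] U show "X \<in> properly_feudal_classes"
        by (auto simp: feudal_class_of_eq properly_feudal_classes_def quotient_def)
    qed
    show "properly_feudal_classes \<subseteq> ?F ` feudal_hom_classes"
    proof
      fix X :: "'a multimagma set" assume "X \<in> properly_feudal_classes"
      then obtain L where L: "properly_feudal L" "X = properly_feudal_iso `` {L}"
        by (auto simp: properly_feudal_classes_def quotient_def)
      obtain U :: "('a, 'a) hom_data" where U: "feudal_hom U" "mm_iso L (feudal_of_hom U)"
        using properly_feudal_imp_feudal_of_hom[OF L(1)] by blast
      have "X = ?F (feudal_hom_iso `` {U})"
        using iso_copies_eq_class(2)[OF U] L U by (simp add: feudal_class_of_eq)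
      moreover have "feudal_hom_iso `` {U} \<in> feudal_hom_classes"
        using U by (simp add: feudal_hom_classes_def quotientI)
      ultimately show "X \<in> ?F ` feudal_hom_classes" by blast
    qed
  qed
  ultimately show ?thesis by (simp add: bij_betw_def)
qed

end
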